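(* Let $\bar A$ specify a random graph with independent edges satisfying $(\epsilon,\delta)$-concentration for some $\epsilon,\delta\in(0,1)$, and let $\beta>0$ and $b\in\mathbb{R}^n_{\ge0}$. Then with probability at least $1-\delta$ over the draw of $A$ from $\bar A$, the following holds: if the spectral radius of $A$ is less than $1/\beta$, then there is $C_0$ such that for every budget $C\ge C_0$ the intervention $y=\sqrt C\,v_1(\bar A)$ has competitive ratio $W(y)/W(y^* )\ge1-\epsilon$ in the network game on $A$.
   Context: Random graph with independent edges: given a symmetric $\bar A\in[0,1]^{n\times n}$, a graph with adjacency matrix $A$ is sampled by including each edge $\{i,j\}$ independently with probability $\bar A_{ij}$. $v_1(\bar A)$ is the unit eigenvector for the largest eigenvalue $\lambda_1(\bar A)$, with the sign chosen to have nonnegative entries. The inverted spectral gap of $\bar A$ is the smallest $\kappa$ with $|\lambda_i(\bar A)|\le\kappa\lambda_1(\bar A)$ for all $i>1$. $\bar A$ satisfies $(\epsilon,\delta)$-concentration if: (1) the maximum expected degree $d_{\max}=\max_i\sum_j\bar A_{ij}$ is at least $\frac49\log(2n/\delta)$; (2) the inverted spectral gap of $\bar A$ is at most $\kappa$ for some $\kappa<1$; (3) $\lambda_1(\bar A)(1-\kappa^2)\ge\frac{1024\sqrt{d_{\max}\log(2n/\delta)}}{\epsilon^2}$. Network game: agent $i$ has utility $u_i(a)=b_ia_i-\tfrac12a_i^2+\beta\sum_jA_{ij}a_ia_j$; $M=I-\beta A$; an intervention $y$ replaces $b$ by $b+y$ and yields equilibrium welfare $W(y)=\tfrac12\|M^{-1}(b+y)\|^2$;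 the optimal intervention of budget $C$ is $y^*\in\arg\max_{\|x\|=\sqrt C}W(x)$; the competitive ratio of $y$ is $W(y)/W(y^* )$. *)

theory Defs
  imports "Jordan_Normal_Form.Spectral_Radius" "HOL-Probability.Product_PMF"
begin

(* Eigenvalues (with multiplicity) of a real square matrix: the real roots of its
   characteristic polynomial.  For symmetric real matrices these are all eigenvalues. *)
definition eigvals :: "real mat \<Rightarrow> real multiset" where
  "eigvals A = proots (char_poly A)"

definition lambda1 :: "real mat \<Rightarrow> real" where
  "lambda1 A = Max (set_mset (eigvals A))"

definition other_eigvals :: "real mat \<Rightarrow> real multiset" where
  "other_eigvals A = eigvals A - {# lambda1 A #}"

definition vnorm :: "real Matrix.vec \<Rightarrow> real" where
  "vnorm x = sqrt (scalar_prod x x)"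

definition v1 :: "real mat \<Rightarrow> real Matrix.vec" where
  "v1 A = (SOME v. v \<in> carrier_vec (dim_row A) \<and> eigenvector A v (lambda1 A) \<and>
              vnorm v = 1 \<and> (\<forall>i < dim_row A. vec_index v i \<ge> 0))"

(* "the inverted spectral gap of A is at most kappa" (the inverted spectral gap is the
   smallest such kappa, and the condition is upward closed) *)
definition inv_gap_le :: "real mat \<Rightarrow> real \<Rightarrow> bool" where
  "inv_gap_le A \<kappa> \<longleftrightarrow> (\<forall>\<mu> \<in># other_eigvals A. \<bar>\<mu>\<bar> \<le> \<kappa> * lambda1 A)"

definition d_max :: "nat \<Rightarrow> real mat \<Rightarrow> real" where
  "d_max n Ab = Max {(\<Sum>j<n. Ab $$ (i, j)) | i. i < n}"

definition concentration :: "nat \<Rightarrow> real mat \<Rightarrow> real \<Rightarrow> real \<Rightarrow> bool" where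
  "concentration n Ab \<epsilon> \<delta> \<longleftrightarrow>
     d_max n Ab \<ge> 4/9 * ln (2 * real n / \<delta>) \<and>
     (\<exists>\<kappa> < 1. inv_gap_le Ab \<kappa> \<and>
        lambda1 Ab * (1 - \<kappa>^2) \<ge> 1024 * sqrt (d_max n Ab * ln (2 * real n / \<delta>)) / \<epsilon>^2)"

definition edge_prob_matrix :: "nat \<Rightarrow> real mat \<Rightarrow> bool" where
  "edge_prob_matrix n Ab \<longleftrightarrow> Ab \<in> carrier_mat n n \<and>
     (\<forall>i<n. \<forall>j<n. Ab $$ (i, j) = Ab $$ (j, i) \<and> 0 \<le> Ab $$ (i, j) \<and> Ab $$ (i, j) \<le> 1)"

(* Random graph with independent edges: each unordered pair {i,j} (i \<le> j, loops allowed
   exactly when Ab(i,i) > 0) is an edge independently with probability Ab(i,j). *)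
definition random_graph :: "nat \<Rightarrow> real mat \<Rightarrow> real mat pmf" where
  "random_graph n Ab =
     map_pmf (\<lambda>E. Matrix.mat n n (\<lambda>(i, j). if E (min i j, max i j) then 1 else 0))
       (Pi_pmf {(i, j). i \<le> j \<and> j < n} False (\<lambda>(i, j). bernoulli_pmf (Ab $$ (i, j))))"

definition welfare :: "nat \<Rightarrow> real \<Rightarrow> real mat \<Rightarrow> real Matrix.vec \<Rightarrow> real Matrix.vec \<Rightarrow> real" where
  "welfare n \<beta> A b y =
     (let M = 1\<^sub>m n - \<beta> \<cdot>\<^sub>m A in (1/2) * (vnorm (the (mat_inverse M) *\<^sub>v (b + y)))^2)"

definition opt_welfare :: "nat \<Rightarrow> real \<Rightarrow> real mat \<Rightarrow> real Matrix.vec \<Rightarrow> real \<Rightarrow> real" where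
  "opt_welfare n \<beta> A b C =
     Sup {welfare n \<beta> A b x | x. x \<in> carrier_vec n \<and> vnorm x = sqrt C}"

definition competitive_ratio :: "nat \<Rightarrow> real \<Rightarrow> real mat \<Rightarrow> real Matrix.vec \<Rightarrow> real \<Rightarrow> real Matrix.vec \<Rightarrow> real" where
  "competitive_ratio n \<beta> A b C y = welfare n \<beta> A b y / opt_welfare n \<beta> A b C"

end

theory Submission
  imports Defs
begin

text \<open>
  Write X for the difference between the sampled matrix and the matrix of edge probabilities, d for
  the maximal expected degree and L for ln (2n/\<delta>). The quadratic form of X is controlled on all
  unit vectors by the moment method. The expected trace of the 2k-th power of X is a sum over closed
  walks in which every edge is traversed at least twice. Along such a walk a step over a new edge
  contributes at most d in total, a step over an old edge has at most k targets, and there are at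
  most k new edges; so the trace is at most n (4Dk)^k in expectation for any D at least d and k.
  With k a power of two between L and 2L and D = 5d, Markov's inequality bounds the quadratic form
  by 16 sqrt(dL) with probability at least 1 - \<delta>.

  On this event, comparing Rayleigh quotients shows that the top eigenvector u of the sampled
  matrix and v of the expected matrix satisfy (1 - (u,v)^2)(1 - \<kappa>) \<lambda> \<le> 32 sqrt(dL), where
  \<lambda> is the top eigenvalue of the expected matrix. Hence (u,v)^2 > 1 - \<epsilon>. In an eigenbasis of
  the sampled matrix the operator taking incentives to equilibrium actions is diagonal with its
  largest entry at u, so for large budgets the competitive ratio tends to a limit that is at least
  (u,v)^2.
\<close>

unbundle no inner_syntax and no vec_syntax

section \<open>Diagonalisation of real symmetric matrices\<close>

text \<open>For an eigenvector \<open>v\<close>, the Hermitian form \<open>S\<close> equals the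
  eigenvalue times the nonzero real \<open>N\<close>, and symmetry of \<open>A\<close> makes
  \<open>S\<close> its own conjugate.\<close>

lemma eigenvalue_real_symmetric_is_real:
  fixes A :: "real mat"
  assumes A: "A \<in> carrier_mat n n" and sym: "A\<^sup>T = A"
    and ev: "eigenvalue (map_mat complex_of_real A) a"
  shows "a \<in> \<real>"
proof -
  from ev obtain v where v: "v \<in> carrier_vec n" "v \<noteq> 0\<^sub>v n"
    and Av: "map_mat complex_of_real A *\<^sub>v v = a \<cdot>\<^sub>v v"
    using A unfolding eigenvalue_def eigenvector_def by auto
  have symA: "A $$ (i, j) = A $$ (j, i)" if "i < n" "j < n" for i j
    using arg_cong[OF sym, of "\<lambda>B. B $$ (i, j)"] A that by simp
  define S where "S = (\<Sum>i<n. \<Sum>j<n. cnj (v $ i) * complex_of_real (A $$ (i, j)) * v $ j)"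
  define N where "N = (\<Sum>i<n. (cmod (v $ i))\<^sup>2)"
  have row: "(\<Sum>j<n. complex_of_real (A $$ (i, j)) * v $ j) = a * v $ i" if "i < n" for i
    using arg_cong[OF Av, of "\<lambda>w. w $ i"] A v that
    by (simp add: scalar_prod_def lessThan_atLeast0)
  have "S = (\<Sum>i<n. cnj (v $ i) * (a * v $ i))"
    unfolding S_def by (intro sum.cong refl) (simp add: row[symmetric] sum_distrib_left mult.assoc)
  also have "\<dots> = a * complex_of_real N"
    unfolding N_def of_real_sum sum_distrib_left
    by (intro sum.cong refl) (simp add: complex_norm_square mult_ac del: of_real_power)
  finally have S: "S = a * complex_of_real N" .
  have "cnj S = (\<Sum>i<n. \<Sum>j<n. v $ i * complex_of_real (A $$ (i, j)) * cnj (v $ j))"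
    by (simp add: S_def)
  also have "\<dots> = (\<Sum>j<n. \<Sum>i<n. v $ i * complex_of_real (A $$ (i, j)) * cnj (v $ j))"
    by (rule sum.swap)
  also have "\<dots> = S"
    unfolding S_def by (intro sum.cong refl) (simp add: symA mult_ac)
  finally have "cnj a * complex_of_real N = a * complex_of_real N" unfolding S by simp
  moreover have "N \<noteq> 0"
  proof
    assume "N = 0"
    hence "\<forall>i\<in>{..<n}. (cmod (v $ i))\<^sup>2 = 0"
      unfolding N_def by (subst (asm) sum_nonneg_eq_0_iff) auto
    hence "v = 0\<^sub>v n" using v by (intro eq_vecI) auto
    thus False using v by simp
  qed
  ultimately show ?thesis by (simp add: Reals_cnj_iff)
qed

text \<open>The characteristic polynomial splits over the complex numbers. All its roots are real,
  and embedding real polynomials is injective, so the factorisation descends.\<close>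

lemma char_poly_real_symmetric_splits:
  fixes A :: "real mat"
  assumes A: "A \<in> carrier_mat n n" and sym: "A\<^sup>T = A"
  shows "\<exists>es. char_poly A = (\<Prod>e\<leftarrow>es. [:- e, 1:])"
proof -
  interpret h: map_poly_comm_ring_hom complex_of_real ..
  let ?A = "map_mat complex_of_real A"
  have cA: "?A \<in> carrier_mat n n" using A by simp
  obtain as where as: "char_poly ?A = (\<Prod>a\<leftarrow>as. [:- a, 1:])"
    using char_poly_factorized[OF cA] by blast
  have "a \<in> \<real>" if "a \<in> set as" for a
  proof -
    have "poly (char_poly ?A) a = 0"
      unfolding as using that by (induction as) auto
    hence "eigenvalue ?A a" using eigenvalue_root_char_poly[OF cA] by simp
    thus ?thesis using eigenvalue_real_symmetric_is_real[OF A sym] by simp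
  qed
  hence "map (complex_of_real \<circ> Re) as = as"
    by (intro map_idI) (simp add: of_real_Re)
  hence "char_poly ?A = (\<Prod>a\<leftarrow>map Re as. [:- complex_of_real a, 1:])"
    unfolding as by (metis (no_types, lifting) comp_apply list.map_comp map_cong)
  also have "\<dots> = map_poly complex_of_real (\<Prod>a\<leftarrow>map Re as. [:- a, 1:])"
    by (induction as) (simp_all add: h.hom_mult hom_distribs)
  finally have "map_poly complex_of_real (char_poly A) =
      map_poly complex_of_real (\<Prod>a\<leftarrow>map Re as. [:- a, 1:])"
    using of_real_hom.char_poly_hom[OF A, where 'a = complex] by simp
  hence "char_poly A = (\<Prod>a\<leftarrow>map Re as. [:- a, 1:])"
    by (simp add: poly_eq_iff coeff_map_poly)
  thus ?thesis by blast
qed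

text \<open>Provides the change of basis that splits off one eigenvector in the
  diagonalisation.\<close>

lemma orthogonal_mat_with_first_col:
  fixes v :: "real Matrix.vec"
  assumes v: "v \<in> carrier_vec n" and v1: "v \<bullet> v = 1" and n: "0 < n"
  shows "\<exists>H\<in>carrier_mat n n. H\<^sup>T * H = 1\<^sub>m n \<and> col H 0 = v"
proof (cases "v = unit_vec n 0")
  case True
  thus ?thesis using n by (intro bexI[of _ "1\<^sub>m n"]) auto
next
  case False
  \<comment> \<open>the Householder reflection that swaps v and the first unit vector\<close>
  define w where "w i = v $ i - of_bool (i = 0)" for i
  define s where "s = (\<Sum>i<n. (w i)\<^sup>2)"
  define H where "H = Matrix.mat n n (\<lambda>(i, j). of_bool (i = j) - 2 / s * (w i * w j))"
  have H: "H \<in> carrier_mat n n" by (simp add: H_def)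
  have HT: "H\<^sup>T = H" by (rule eq_matI) (auto simp: H_def mult_ac)
  have vv: "(\<Sum>i<n. (v $ i)\<^sup>2) = 1"
    using v v1 by (simp add: scalar_prod_def lessThan_atLeast0 power2_eq_square)
  have del: "(\<Sum>l<n. of_bool (l = i) * f l) = f i" if "i < n" for i and f :: "nat \<Rightarrow> real"
    using that by (simp add: of_bool_def if_distrib[of "\<lambda>x. x * _"] sum.delta cong: if_cong)
  have "s = (\<Sum>i<n. (v $ i)\<^sup>2 - 2 * (of_bool (i = 0) * v $ i) + of_bool (i = 0) * 1)"
    unfolding s_def w_def by (intro sum.cong) (auto simp: power2_diff)
  also have "\<dots> = 2 - 2 * v $ 0"
    by (simp only: sum.distrib sum_subtractf vv sum_distrib_left[symmetric] del[OF n])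
  finally have s: "s = 2 - 2 * v $ 0" .
  have s0: "s \<noteq> 0"
  proof
    assume "s = 0"
    hence "\<forall>i\<in>{..<n}. (w i)\<^sup>2 = 0"
      unfolding s_def by (subst (asm) sum_nonneg_eq_0_iff) auto
    hence "v = unit_vec n 0" using v by (intro eq_vecI) (auto simp: w_def split: if_splits)
    thus False using False by simp
  qed
  \<comment> \<open>The two cross terms add up to \<open>- 4 / s * w i * w j\<close>, and the
    quadratic term contributes \<open>4 / s\<^sup>2 * w i * w j * s\<close>, which cancels
    them.\<close>
  have "H * H = 1\<^sub>m n"
  proof (rule eq_matI)
    fix i j assume "i < dim_row (1\<^sub>m n :: real mat)" "j < dim_col (1\<^sub>m n :: real mat)"
    hence ij: "i < n" "j < n" by auto
    have "(H * H) $$ (i, j) = (\<Sum>l<n. H $$ (i, l) * H $$ (l, j))"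
      using ij H by (simp add: scalar_prod_def lessThan_atLeast0)
    also have "\<dots> = (\<Sum>l<n. of_bool (l = i) * of_bool (l = j)
        - 2 / s * w j * (of_bool (l = i) * w l) - 2 / s * w i * (of_bool (l = j) * w l)
        + (2 / s)\<^sup>2 * w i * w j * (w l)\<^sup>2)"
      using ij by (intro sum.cong) (auto simp: H_def algebra_simps power2_eq_square)
    also have "\<dots> = of_bool (i = j) - 2 / s * w j * w i - 2 / s * w i * w j
        + (2 / s)\<^sup>2 * w i * w j * s"
      unfolding s_def by (simp only: sum.distrib sum_subtractf sum_distrib_left[symmetric] del[OF ij(1)] del[OF ij(2)])
    also have "\<dots> = of_bool (i = j)" using s0 by (simp add: field_simps power2_eq_square)
    finally show "(H * H) $$ (i, j) = 1\<^sub>m n $$ (i, j)" using ij by simp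
  qed (auto simp: H_def)
  moreover have "col H 0 = v"
  proof (rule eq_vecI)
    fix i assume "i < dim_vec v"
    hence i: "i < n" using v by simp
    \<comment> \<open>With this value the coefficient \<open>- 2 / s * w 0\<close> of
      \<open>w i\<close> in the first column is 1, so that column is the first unit vector plus
      \<open>w\<close>, which is \<open>v\<close>.\<close>
    have "w 0 = - s / 2" using s by (simp add: w_def)
    hence "H $$ (i, 0) = of_bool (i = 0) + w i" using i n s0 by (simp add: H_def)
    thus "col H 0 $ i = v $ i" using i n H by (simp add: w_def)
  qed (use v H in auto)
  ultimately show ?thesis using H HT by (intro bexI[of _ H]) simp_all
qed

text \<open>Deflation, by induction on the list of roots: \<open>H\<close> moves an eigenvector of
  the first root to the first coordinate, symmetry clears the rest of the first row and column, and
  the remaining block has the remaining roots. The order of \<open>es\<close> is kept on the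
  diagonal, so that a chosen root can later be placed first.\<close>

lemma real_symmetric_diagonalization:
  fixes A :: "real mat"
  assumes "A \<in> carrier_mat n n" "A\<^sup>T = A" "char_poly A = (\<Prod>e\<leftarrow>es. [:- e, 1:])"
  shows "\<exists>Q\<in>carrier_mat n n. Q\<^sup>T * Q = 1\<^sub>m n \<and> Q\<^sup>T * A * Q = mat_diag n (\<lambda>i. es ! i)"
  using assms
proof (induction es arbitrary: n A)
  case Nil
  hence "n = 0" using degree_monic_char_poly[of A n] by simp
  thus ?case using Nil by (intro bexI[of _ "1\<^sub>m 0"]) (auto simp: mat_diag_def intro!: eq_matI)
next
  case (Cons e es)
  note A = Cons.prems(1) and sym = Cons.prems(2)
  have cp: "char_poly A = [:- e, 1:] * (\<Prod>e\<leftarrow>es. [:- e, 1:])" using Cons.prems by simp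
  have "eigenvalue A e" unfolding eigenvalue_root_char_poly[OF A] cp by simp
  then obtain u where u: "u \<in> carrier_vec n" "u \<noteq> 0\<^sub>v n" "A *\<^sub>v u = e \<cdot>\<^sub>v u"
    using A unfolding eigenvalue_def eigenvector_def by auto
  have n: "0 < n" using u by (cases n) (auto intro: eq_vecI)
  then obtain m where m: "n = Suc m" by (cases n) auto
  have uu: "0 < u \<bullet> u"
    using u(1,2) conjugate_square_greater_0_vec[OF u(1)] by simp
  define v where "v = (1 / sqrt (u \<bullet> u)) \<cdot>\<^sub>v u"
  have v: "v \<in> carrier_vec n" using u by (simp add: v_def)
  have "v \<bullet> v = 1" using u uu by (simp add: v_def)
  have Av: "A *\<^sub>v v = e \<cdot>\<^sub>v v"
    unfolding v_def mult_mat_vec[OF A u(1)] u(3) by (simp add: smult_smult_assoc mult.commute)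
  obtain H where H: "H \<in> carrier_mat n n" and HH: "H\<^sup>T * H = 1\<^sub>m n" and Hv: "col H 0 = v"
    using orthogonal_mat_with_first_col[OF v \<open>v \<bullet> v = 1\<close> n] by blast
  have HH': "H * H\<^sup>T = 1\<^sub>m n" using mat_mult_left_right_inverse[OF _ H HH] H by simp
  define B where "B = H\<^sup>T * A * H"
  have B: "B \<in> carrier_mat n n" using A H by (simp add: B_def)
  have BT: "B\<^sup>T = B"
    unfolding B_def using A H sym by (simp add: transpose_mult[of _ n n _ n] assoc_mult_mat[of _ n n _ n _ n])
  have B0: "B $$ (i, 0) = (if i = 0 then e else 0)" if i: "i < n" for i
  proof -
    have "B = H\<^sup>T * (A * H)" using A H by (simp add: B_def assoc_mult_mat[of _ n n _ n _ n])
    hence "B $$ (i, 0) = Matrix.row H\<^sup>T i \<bullet> col (A * H) 0" using i n A H by simp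
    also have "col (A * H) 0 = A *\<^sub>v col H 0"
      using n A H by (intro eq_vecI) auto
    also have "\<dots> = e \<cdot>\<^sub>v col H 0" using Av Hv by simp
    also have "Matrix.row H\<^sup>T i \<bullet> (e \<cdot>\<^sub>v col H 0) = e * (H\<^sup>T * H) $$ (i, 0)"
      using i n H by simp
    finally show ?thesis unfolding HH using i n by simp
  qed
  have B0': "B $$ (0, i) = (if i = 0 then e else 0)" if i: "i < n" for i
    using arg_cong[OF BT, of "\<lambda>M. M $$ (i, 0)"] B0[OF i] B i n by simp
  define A1 where "A1 = Matrix.mat 1 1 (\<lambda>_. e)"
  define A3 where "A3 = Matrix.mat m m (\<lambda>(i, j). B $$ (Suc i, Suc j))"
  have A1: "A1 \<in> carrier_mat 1 1" and A3: "A3 \<in> carrier_mat m m" by (auto simp: A1_def A3_def)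
  have block: "B = four_block_mat A1 (0\<^sub>m 1 m) (0\<^sub>m m 1) A3"
    using B B0 B0' m by (intro eq_matI) (auto simp: A1_def A3_def)
  have A3T: "A3\<^sup>T = A3"
  proof (rule eq_matI)
    fix i j assume "i < dim_row A3" "j < dim_col A3"
    hence ij: "i < m" "j < m" by (auto simp: A3_def)
    thus "A3\<^sup>T $$ (i, j) = A3 $$ (i, j)"
      using arg_cong[OF BT, of "\<lambda>M. M $$ (Suc i, Suc j)"] B m by (simp add: A3_def)
  qed (auto simp: A3_def)
  have "similar_mat_wit B A H\<^sup>T H"
    by (rule similar_mat_witI[of _ _ n]) (use HH HH' H A B in \<open>auto simp: B_def\<close>)
  hence "char_poly B = char_poly A" by (intro char_poly_similar) (auto simp: similar_mat_def)
  moreover have "char_poly B = char_poly A1 * char_poly A3"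
    unfolding block by (rule char_poly_four_block_zeros_col[OF A1 _ A3]) simp
  moreover have "char_poly A1 = [:- e, 1:]"
    by (simp add: A1_def char_poly_defs Determinant.det_def sign_def)
  ultimately have "char_poly A3 = (\<Prod>e\<leftarrow>es. [:- e, 1:])"
    unfolding cp by (metis mult_cancel_left pCons_eq_0_iff zero_neq_one)
  from Cons.IH[OF A3 A3T this] obtain R where R: "R \<in> carrier_mat m m" "R\<^sup>T * R = 1\<^sub>m m"
    "R\<^sup>T * A3 * R = mat_diag m (\<lambda>i. es ! i)" by blast
  \<comment> \<open>\<open>F\<close> acts by \<open>R\<close> on the last \<open>m\<close>
    coordinates only and so leaves the entry \<open>e\<close> in place.\<close>
  define F where "F = four_block_mat (1\<^sub>m 1) (0\<^sub>m 1 m) (0\<^sub>m m 1) R"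
  have FT: "F\<^sup>T = four_block_mat (1\<^sub>m 1) (0\<^sub>m 1 m) (0\<^sub>m m 1) R\<^sup>T"
    unfolding F_def using R by (subst transpose_four_block_mat[of _ 1 1 _ m _ m]) auto
  have F: "F \<in> carrier_mat n n" unfolding F_def m using R by auto
  have mul: "four_block_mat X (0\<^sub>m 1 m) (0\<^sub>m m 1) Y * four_block_mat X' (0\<^sub>m 1 m) (0\<^sub>m m 1) Y'
      = four_block_mat (X * X') (0\<^sub>m 1 m) (0\<^sub>m m 1) (Y * Y')"
    if "X \<in> carrier_mat 1 1" "X' \<in> carrier_mat 1 1" "Y \<in> carrier_mat m m" "Y' \<in> carrier_mat m m"
    for X X' Y Y' :: "real mat"
    using that by (subst mult_four_block_mat[of _ 1 1 _ m _ m]) auto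
  have FF: "F\<^sup>T * F = 1\<^sub>m n" unfolding FT unfolding F_def using R m by (subst mul) auto
  have FB: "F\<^sup>T * B = four_block_mat (1\<^sub>m 1 * A1) (0\<^sub>m 1 m) (0\<^sub>m m 1) (R\<^sup>T * A3)"
    unfolding FT block using R(1) A1 A3 by (intro mul) auto
  have "F\<^sup>T * B * F = four_block_mat (1\<^sub>m 1 * A1 * 1\<^sub>m 1) (0\<^sub>m 1 m) (0\<^sub>m m 1) (R\<^sup>T * A3 * R)"
    unfolding FB unfolding F_def using R(1) A1 A3 by (intro mul) auto
  also have "1\<^sub>m 1 * A1 * 1\<^sub>m 1 = A1" using A1 by simp
  also have "four_block_mat A1 (0\<^sub>m 1 m) (0\<^sub>m m 1) (R\<^sup>T * A3 * R) = mat_diag n (\<lambda>i. (e # es) ! i)"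
    unfolding R m by (intro eq_matI) (auto simp: A1_def mat_diag_def nth_Cons')
  finally have FBF: "F\<^sup>T * B * F = mat_diag n (\<lambda>i. (e # es) ! i)" .
  have "(H * F)\<^sup>T * (H * F) = F\<^sup>T * (H\<^sup>T * H) * F"
    using H F by (simp add: transpose_mult[of _ n n _ n] assoc_mult_mat[of _ n n _ n _ n] del: assoc_mult_mat)
  hence 1: "(H * F)\<^sup>T * (H * F) = 1\<^sub>m n" using HH FF F by simp
  have "(H * F)\<^sup>T * A * (H * F) = F\<^sup>T * B * F"
    unfolding B_def using H F A by (simp add: transpose_mult[of _ n n _ n] assoc_mult_mat[of _ n n _ n _ n])
  thus ?case using 1 FBF H F by (intro bexI[of _ "H * F"]) auto
qed

section \<open>Inner products and coordinates in an orthonormal eigenbasis\<close>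

lemma scalar_prod_sum: "y \<in> carrier_vec n \<Longrightarrow> x \<bullet> y = (\<Sum>i<n. x $ i * y $ i)"
  by (simp add: scalar_prod_def lessThan_atLeast0)

lemma scalar_prod_Cauchy_Schwarz:
  fixes x y :: "real Matrix.vec"
  assumes "x \<in> carrier_vec n" "y \<in> carrier_vec n"
  shows "(x \<bullet> y)\<^sup>2 \<le> (x \<bullet> x) * (y \<bullet> y)"
  using Cauchy_Schwarz_ineq_sum[of "\<lambda>i. x $ i" "\<lambda>i. y $ i" "{..<n}"] assms
  by (simp add: scalar_prod_sum power2_eq_square)

lemma scalar_prod_self_nonneg: "0 \<le> (x :: real Matrix.vec) \<bullet> x"
  by (simp add: scalar_prod_def sum_nonneg)

lemma scalar_prod_symmetric_mat:
  fixes A :: "real mat"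
  assumes "A \<in> carrier_mat n n" "A\<^sup>T = A" "x \<in> carrier_vec n" "y \<in> carrier_vec n"
  shows "(A *\<^sub>v x) \<bullet> y = x \<bullet> (A *\<^sub>v y)"
  using transpose_vec_mult_scalar[OF assms(1,4,3)] assms
    comm_scalar_prod[of "A *\<^sub>v y" n x] comm_scalar_prod[of "A *\<^sub>v x" n y]
  by simp

lemma vnorm_eq_1_iff: "vnorm x = 1 \<longleftrightarrow> x \<bullet> x = 1"
  by (simp add: vnorm_def)

lemma vnorm_squared: "(vnorm x)\<^sup>2 = x \<bullet> x"
  by (simp add: vnorm_def scalar_prod_self_nonneg)

text \<open>The columns of \<open>Q\<close> are an orthonormal eigenbasis. Only a largest eigenvalue
  has a prescribed place, index 0; the others come in any order and may equal it.\<close>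

locale spectral_frame =
  fixes n :: nat and A Q :: "real mat" and \<mu> :: "nat \<Rightarrow> real"
  assumes n_pos: "0 < n"
    and A: "A \<in> carrier_mat n n"
    and Q: "Q \<in> carrier_mat n n"
    and QTQ: "Q\<^sup>T * Q = 1\<^sub>m n"
    and diag: "Q\<^sup>T * A * Q = mat_diag n \<mu>"
    and top: "\<And>i. i < n \<Longrightarrow> \<mu> i \<le> \<mu> 0"
begin

definition coord :: "real Matrix.vec \<Rightarrow> real Matrix.vec" where
  "coord x = Q\<^sup>T *\<^sub>v x"

lemma coord_carrier [simp]: "x \<in> carrier_vec n \<Longrightarrow> coord x \<in> carrier_vec n"
  using Q unfolding coord_def by simp

lemma dim_coord [simp]: "dim_vec (coord x) = n"
  using Q unfolding coord_def by simp

lemma QQT: "Q * Q\<^sup>T = 1\<^sub>m n"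
  using mat_mult_left_right_inverse[OF _ Q QTQ] Q by simp

lemma coord_inverse: "x \<in> carrier_vec n \<Longrightarrow> Q *\<^sub>v coord x = x"
  using assoc_mult_mat_vec[of Q n n "Q\<^sup>T" n x] Q QQT by (simp add: coord_def)

lemma coord_inj: "x \<in> carrier_vec n \<Longrightarrow> y \<in> carrier_vec n \<Longrightarrow> coord x = coord y \<Longrightarrow> x = y"
  by (metis coord_inverse)

lemma scalar_prod_coord:
  assumes "x \<in> carrier_vec n" "y \<in> carrier_vec n"
  shows "x \<bullet> y = (\<Sum>i<n. coord x $ i * coord y $ i)"
proof -
  have "coord x \<bullet> coord y = (Q *\<^sub>v coord x) \<bullet> y"
    using transpose_vec_mult_scalar[OF Q, of "coord x" y] assms
      comm_scalar_prod[of "coord x" n "coord y"] comm_scalar_prod[of y n "Q *\<^sub>v coord x"] Q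
    by (simp add: coord_def)
  thus ?thesis using assms by (simp add: coord_inverse scalar_prod_sum[of _ n])
qed

lemma coord_mult:
  assumes x: "x \<in> carrier_vec n" and i: "i < n"
  shows "coord (A *\<^sub>v x) $ i = \<mu> i * coord x $ i"
proof -
  have "coord (A *\<^sub>v x) = Q\<^sup>T *\<^sub>v (A *\<^sub>v (Q *\<^sub>v coord x))"
    using x by (simp add: coord_inverse) (simp add: coord_def)
  also have "\<dots> = (Q\<^sup>T * A * Q) *\<^sub>v coord x"
    using x A Q by (simp add: assoc_mult_mat_vec[of _ n n _ n])
  finally have "coord (A *\<^sub>v x) $ i = (mat_diag n \<mu> *\<^sub>v coord x) $ i" unfolding diag by simp
  also have "\<dots> = (\<Sum>j<n. if j = i then \<mu> i * coord x $ j else 0)"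
    using i x coord_carrier[OF x]
    by (simp add: mat_diag_def scalar_prod_sum[of _ n] if_distrib[of "\<lambda>z. z * _"] cong: if_cong)
  also have "\<dots> = \<mu> i * coord x $ i" using i by simp
  finally show ?thesis .
qed

lemma quadratic_form_coord:
  assumes x: "x \<in> carrier_vec n"
  shows "x \<bullet> (A *\<^sub>v x) = (\<Sum>i<n. \<mu> i * (coord x $ i)\<^sup>2)"
  using A by (simp add: scalar_prod_coord x coord_mult power2_eq_square mult_ac)

lemma norm_coord: "x \<in> carrier_vec n \<Longrightarrow> x \<bullet> x = (\<Sum>i<n. (coord x $ i)\<^sup>2)"
  by (simp add: scalar_prod_coord power2_eq_square)

lemma rayleigh_le:
  assumes x: "x \<in> carrier_vec n"
  shows "x \<bullet> (A *\<^sub>v x) \<le> \<mu> 0 * (x \<bullet> x)"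
  unfolding quadratic_form_coord[OF x] norm_coord[OF x] sum_distrib_left
  using top by (intro sum_mono mult_right_mono) auto

text \<open>The defect is a sum of nonnegative terms
  \<open>(\<mu> 0 - \<mu> i) * (coord x $ i)\<^sup>2\<close>, so each vanishes: \<open>x\<close> is
  supported on coordinates with eigenvalue \<open>\<mu> 0\<close>.\<close>

lemma rayleigh_eq_imp_eigenvector:
  assumes x: "x \<in> carrier_vec n" and eq: "\<mu> 0 * (x \<bullet> x) \<le> x \<bullet> (A *\<^sub>v x)"
  shows "A *\<^sub>v x = \<mu> 0 \<cdot>\<^sub>v x"
proof -
  have "(\<Sum>i<n. (\<mu> 0 - \<mu> i) * (coord x $ i)\<^sup>2) = \<mu> 0 * (x \<bullet> x) - x \<bullet> (A *\<^sub>v x)"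
    unfolding quadratic_form_coord[OF x] norm_coord[OF x]
    by (simp add: sum_distrib_left sum_subtractf left_diff_distrib)
  hence "(\<Sum>i<n. (\<mu> 0 - \<mu> i) * (coord x $ i)\<^sup>2) \<le> 0" using eq by simp
  hence "(\<Sum>i<n. (\<mu> 0 - \<mu> i) * (coord x $ i)\<^sup>2) = 0"
    using top by (intro order.antisym sum_nonneg) auto
  hence z: "\<forall>i\<in>{..<n}. (\<mu> 0 - \<mu> i) * (coord x $ i)\<^sup>2 = 0"
    using top by (subst (asm) sum_nonneg_eq_0_iff) auto
  show ?thesis
  proof (rule coord_inj)
    show "coord (A *\<^sub>v x) = coord (\<mu> 0 \<cdot>\<^sub>v x)"
    proof (rule eq_vecI)
      fix i assume "i < dim_vec (coord (\<mu> 0 \<cdot>\<^sub>v x))"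
      hence i: "i < n" by simp
      have "coord (\<mu> 0 \<cdot>\<^sub>v x) = \<mu> 0 \<cdot>\<^sub>v coord x"
        using Q x unfolding coord_def by (simp add: mult_mat_vec[of _ n n])
      thus "coord (A *\<^sub>v x) $ i = coord (\<mu> 0 \<cdot>\<^sub>v x) $ i"
        using bspec[OF z, of i] i x by (auto simp: coord_mult)
    qed (use x A Q in \<open>simp add: coord_def\<close>)
  qed (use x A in auto)
qed

lemma coord_top: "x \<in> carrier_vec n \<Longrightarrow> coord x $ 0 = col Q 0 \<bullet> x"
  using Q n_pos unfolding coord_def by simp

lemma col_top: "col Q 0 \<in> carrier_vec n" "col Q 0 \<bullet> col Q 0 = 1"
proof -
  show "col Q 0 \<in> carrier_vec n" using Q by (intro carrier_vecI) simp
  have "(Q\<^sup>T * Q) $$ (0, 0) = col Q 0 \<bullet> col Q 0" using Q n_pos by simp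
  thus "col Q 0 \<bullet> col Q 0 = 1" unfolding QTQ using n_pos by simp
qed

lemma quadratic_form_col_top: "col Q 0 \<bullet> (A *\<^sub>v col Q 0) = \<mu> 0"
proof -
  have "(Q\<^sup>T * (A * Q)) $$ (0, 0) = col Q 0 \<bullet> col (A * Q) 0" using A Q n_pos by simp
  also have "col (A * Q) 0 = A *\<^sub>v col Q 0"
    using n_pos A Q by (intro eq_vecI) auto
  also have "Q\<^sup>T * (A * Q) = mat_diag n \<mu>"
    using A Q diag by (simp add: assoc_mult_mat[of _ n n _ n _ n])
  finally show ?thesis using n_pos by (simp add: mat_diag_def)
qed

text \<open>The gap makes the top eigenspace one-dimensional, so \<open>v\<close> has only its
  coordinate 0 and \<open>(u \<bullet> v)\<^sup>2\<close> is the squared top coordinate of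
  \<open>u\<close>. The remaining mass of \<open>u\<close> carries eigenvalues at most
  \<open>\<nu>\<close>.\<close>

lemma quadratic_form_le_gap:
  assumes v: "v \<in> carrier_vec n" "v \<bullet> v = 1" "A *\<^sub>v v = \<mu> 0 \<cdot>\<^sub>v v"
    and gap: "\<And>i. 0 < i \<Longrightarrow> i < n \<Longrightarrow> \<mu> i \<le> \<nu>" "\<nu> < \<mu> 0"
    and u: "u \<in> carrier_vec n" "u \<bullet> u = 1"
  shows "u \<bullet> (A *\<^sub>v u) \<le> \<mu> 0 * (u \<bullet> v)\<^sup>2 + \<nu> * (1 - (u \<bullet> v)\<^sup>2)"
proof -
  have split: "(\<Sum>i<n. f i) = f 0 + (\<Sum>i\<in>{..<n} - {0}. f i)" for f :: "nat \<Rightarrow> real"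
    using n_pos by (intro sum.remove) auto
  have z: "coord v $ i = 0" if i: "i \<in> {..<n} - {0}" for i
  proof -
    have "coord (A *\<^sub>v v) = \<mu> 0 \<cdot>\<^sub>v coord v"
      unfolding v(3) using Q v unfolding coord_def by (simp add: mult_mat_vec[of _ n n])
    hence "\<mu> i * coord v $ i = \<mu> 0 * coord v $ i"
      using coord_mult[OF v(1), of i] i coord_carrier[OF v(1)] by auto
    moreover have "\<mu> i < \<mu> 0" using gap i by force
    ultimately show ?thesis by auto
  qed
  have "1 = (coord v $ 0)\<^sup>2" using norm_coord[OF v(1)] v(2) z unfolding split by simp
  moreover have "u \<bullet> v = coord u $ 0 * coord v $ 0"
    using scalar_prod_coord[OF u(1) v(1)] z unfolding split by simp
  ultimately have uv: "(u \<bullet> v)\<^sup>2 = (coord u $ 0)\<^sup>2" by (simp add: power_mult_distrib)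
  have rest: "(\<Sum>i\<in>{..<n} - {0}. (coord u $ i)\<^sup>2) = 1 - (u \<bullet> v)\<^sup>2"
    using norm_coord[OF u(1)] u(2) unfolding uv split by simp
  have "u \<bullet> (A *\<^sub>v u) = \<mu> 0 * (coord u $ 0)\<^sup>2 + (\<Sum>i\<in>{..<n} - {0}. \<mu> i * (coord u $ i)\<^sup>2)"
    unfolding quadratic_form_coord[OF u(1)] by (rule split)
  also have "(\<Sum>i\<in>{..<n} - {0}. \<mu> i * (coord u $ i)\<^sup>2) \<le> (\<Sum>i\<in>{..<n} - {0}. \<nu> * (coord u $ i)\<^sup>2)"
    using gap(1) by (intro sum_mono mult_right_mono) auto
  finally show ?thesis unfolding sum_distrib_left[symmetric] rest uv by simp
qed

end

text \<open>The roots are reordered with \<open>lambda1 A\<close> in front. \<open>remove1\<close>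
  deletes a single occurrence, as \<open>other_eigvals\<close> does, so a multiple top eigenvalue
  reappears at a later index.\<close>

lemma spectral_frame_exists:
  fixes A :: "real mat"
  assumes n: "0 < n" and A: "A \<in> carrier_mat n n" and sym: "A\<^sup>T = A"
  obtains Q \<mu> where "spectral_frame n A Q \<mu>" "\<mu> 0 = lambda1 A"
    "\<And>i. i < n \<Longrightarrow> \<mu> i \<in># eigvals A"
    "\<And>i. 0 < i \<Longrightarrow> i < n \<Longrightarrow> \<mu> i \<in># other_eigvals A"
proof -
  obtain es where es: "char_poly A = (\<Prod>e\<leftarrow>es. [:- e, 1:])"
    using char_poly_real_symmetric_splits[OF A sym] by blast
  have "degree (\<Prod>e\<leftarrow>es. [:- e, 1:]) = length es" by (rule degree_linear_factors)
  hence len: "length es = n" using degree_monic_char_poly[OF A] es by simp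
  have "proots (\<Prod>e\<leftarrow>es. [:- e, 1:]) = mset es"
    by (induction es) (simp_all add: proots_mult prod_list_zero_iff image_iff del: mult_pCons_left)
  hence ev: "eigvals A = mset es" by (simp add: eigvals_def es)
  have mem: "lambda1 A \<in> set es" unfolding lambda1_def ev using Max_in[of "set es"] len n by auto
  have le: "e \<le> lambda1 A" if "e \<in> set es" for e
    unfolding lambda1_def ev using that by (intro Max_ge) auto
  define rs where "rs = lambda1 A # remove1 (lambda1 A) es"
  have rs: "mset rs = mset es" using mem by (simp add: rs_def)
  have "prod_mset (mset (map (\<lambda>e. [:- e, 1:]) rs)) = prod_mset (mset (map (\<lambda>e. [:- e, 1:]) es))"
    unfolding mset_map rs ..
  hence "char_poly A = (\<Prod>e\<leftarrow>rs. [:- e, 1:])"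
    unfolding es prod_mset_prod_list by simp
  from real_symmetric_diagonalization[OF A sym this] obtain Q where
    Q: "Q \<in> carrier_mat n n" "Q\<^sup>T * Q = 1\<^sub>m n" "Q\<^sup>T * A * Q = mat_diag n (\<lambda>i. rs ! i)" by blast
  have lrs: "length rs = n" using rs len by (metis size_mset)
  have nth: "rs ! i \<in> set es" if "i < n" for i
    using that lrs rs by (metis nth_mem set_mset_mset)
  show thesis
  proof (rule that[of Q "\<lambda>i. rs ! i"])
    show "spectral_frame n A Q (\<lambda>i. rs ! i)"
      using n A Q le nth by unfold_locales (auto simp: rs_def)
    show "rs ! i \<in># other_eigvals A" if i: "0 < i" "i < n" for i
    proof -
      have "rs ! i = remove1 (lambda1 A) es ! (i - 1)" using i by (simp add: rs_def nth_Cons')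
      moreover have "i - 1 < length (remove1 (lambda1 A) es)" using i lrs by (simp add: rs_def)
      ultimately have "rs ! i \<in> set (remove1 (lambda1 A) es)" by (metis nth_mem)
      thus ?thesis unfolding other_eigvals_def ev by (metis mset_remove1 set_mset_mset)
    qed
  qed (use nth in \<open>auto simp: rs_def ev\<close>)
qed

section \<open>Top eigenvalue and eigenvector of a nonnegative symmetric matrix\<close>

lemma lambda1_nonneg:
  assumes n: "0 < n" and A: "A \<in> carrier_mat n n" and sym: "A\<^sup>T = A"
    and nonneg: "\<And>i j. i < n \<Longrightarrow> j < n \<Longrightarrow> 0 \<le> A $$ (i, j)"
  shows "0 \<le> lambda1 A"
proof -
  obtain Q \<mu> where "spectral_frame n A Q \<mu>" and \<mu>: "\<mu> 0 = lambda1 A"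
    using spectral_frame_exists[OF n A sym] by metis
  then interpret spectral_frame n A Q \<mu> by simp
  \<comment> \<open>The first unit vector serves as test vector: its Rayleigh quotient is a diagonal
    entry.\<close>
  have "unit_vec n 0 \<bullet> (A *\<^sub>v unit_vec n 0) = A $$ (0, 0)" using n A by simp
  thus ?thesis using rayleigh_le[of "unit_vec n 0"] nonneg[OF n n] n by (simp add: \<mu>)
qed

text \<open>\<open>v1\<close> is defined by choice, so a witness is required. The entrywise absolute
  value \<open>y\<close> of a top eigenvector still attains the maximal Rayleigh quotient and is
  therefore a top eigenvector itself.\<close>

lemma v1_eigenvector:
  assumes n: "0 < n" and A: "A \<in> carrier_mat n n" and sym: "A\<^sup>T = A"
    and nonneg: "\<And>i j. i < n \<Longrightarrow> j < n \<Longrightarrow> 0 \<le> A $$ (i, j)"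
  shows "v1 A \<in> carrier_vec n" "v1 A \<bullet> v1 A = 1" "A *\<^sub>v v1 A = lambda1 A \<cdot>\<^sub>v v1 A"
proof -
  obtain Q \<mu> where "spectral_frame n A Q \<mu>" and \<mu>: "\<mu> 0 = lambda1 A"
    using spectral_frame_exists[OF n A sym] by metis
  then interpret spectral_frame n A Q \<mu> by simp
  define x where "x = col Q 0"
  define y where "y = Matrix.vec n (\<lambda>i. \<bar>x $ i\<bar>)"
  have x: "x \<in> carrier_vec n" "x \<bullet> x = 1" and y: "y \<in> carrier_vec n"
    using col_top by (auto simp: x_def y_def)
  have yy: "y \<bullet> y = 1" using x y by (simp add: scalar_prod_sum y_def)
  have qf: "z \<bullet> (A *\<^sub>v z) = (\<Sum>i<n. \<Sum>j<n. A $$ (i, j) * (z $ i * z $ j))"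
    if "z \<in> carrier_vec n" for z
    using that A by (simp add: scalar_prod_sum[of _ n] sum_distrib_left mult_ac)
  \<comment> \<open>taking absolute values of the entries cannot decrease the quadratic form\<close>
  have "\<mu> 0 * (y \<bullet> y) \<le> y \<bullet> (A *\<^sub>v y)"
  proof -
    have "x \<bullet> (A *\<^sub>v x) \<le> y \<bullet> (A *\<^sub>v y)"
      unfolding qf[OF x(1)] qf[OF y]
      by (intro sum_mono mult_left_mono) (auto simp: y_def nonneg abs_mult[symmetric])
    thus ?thesis unfolding yy x_def by (simp add: quadratic_form_col_top)
  qed
  hence "A *\<^sub>v y = \<mu> 0 \<cdot>\<^sub>v y" by (rule rayleigh_eq_imp_eigenvector[OF y])
  moreover have "y \<noteq> 0\<^sub>v n" using yy by auto
  ultimately have "y \<in> carrier_vec (dim_row A) \<and> eigenvector A y (lambda1 A) \<and>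
      vnorm y = 1 \<and> (\<forall>i < dim_row A. y $ i \<ge> 0)"
    using A y yy \<mu> by (auto simp: eigenvector_def vnorm_eq_1_iff) (simp add: y_def)
  hence "v1 A \<in> carrier_vec (dim_row A) \<and> eigenvector A (v1 A) (lambda1 A) \<and>
      vnorm (v1 A) = 1 \<and> (\<forall>i < dim_row A. v1 A $ i \<ge> 0)"
    unfolding v1_def by (rule someI)
  thus "v1 A \<in> carrier_vec n" "v1 A \<bullet> v1 A = 1" "A *\<^sub>v v1 A = lambda1 A \<cdot>\<^sub>v v1 A"
    using A by (auto simp: eigenvector_def vnorm_eq_1_iff)
qed

section \<open>Walks with repeated edges\<close>

text \<open>Edges are sorted pairs because these index the independent coins of
  \<open>random_graph\<close>; a loop is a pair with equal entries.\<close>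

fun walk_edges :: "nat list \<Rightarrow> (nat \<times> nat) list" where
  "walk_edges (y # x # w) = (min y x, max y x) # walk_edges (x # w)"
| "walk_edges _ = []"

text \<open>Every vertex sequence counts, whether or not its edges are present in a sampled graph;
  \<open>m\<close> is the number of steps.\<close>

definition walks :: "nat \<Rightarrow> nat \<Rightarrow> nat list set" where
  "walks n m = {w. set w \<subseteq> {..<n} \<and> length w = Suc m}"

lemma finite_walks [simp]: "finite (walks n m)"
  unfolding walks_def by (rule finite_lists_length_eq) simp

lemma hd_walk_less: "w \<in> walks n m \<Longrightarrow> hd w < n"
  unfolding walks_def by (cases w) auto

lemma length_walk_edges: "w \<in> walks n m \<Longrightarrow> length (walk_edges w) = m"
proof -
  have "length (walk_edges w) = length w - 1" for w
    by (induction w rule: walk_edges.induct) auto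
  thus "w \<in> walks n m \<Longrightarrow> length (walk_edges w) = m" by (simp add: walks_def)
qed

lemma set_walk_edges: "w \<in> walks n m \<Longrightarrow> set (walk_edges w) \<subseteq> {(i, j). i \<le> j \<and> j < n}"
proof -
  have "set w \<subseteq> {..<n} \<Longrightarrow> set (walk_edges w) \<subseteq> {(i, j). i \<le> j \<and> j < n}" for w
    by (induction w rule: walk_edges.induct) auto
  thus "w \<in> walks n m \<Longrightarrow> set (walk_edges w) \<subseteq> {(i, j). i \<le> j \<and> j < n}"
    by (simp add: walks_def)
qed

lemma walk_edges_Cons:
  "w \<in> walks n m \<Longrightarrow> walk_edges (y # w) = (min y (hd w), max y (hd w)) # walk_edges w"
  unfolding walks_def by (cases w) auto

lemma sum_walks_0: "sum f (walks n 0) = (\<Sum>x<n. f [x])"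
proof -
  have "walks n 0 = (\<lambda>x. [x]) ` {..<n}"
    by (auto simp: walks_def length_Suc_conv image_iff)
  thus ?thesis by (simp add: sum.reindex inj_on_def)
qed

lemma sum_walks_Suc: "sum f (walks n (Suc m)) = (\<Sum>w\<in>walks n m. \<Sum>y<n. f (y # w))"
proof -
  have "walks n (Suc m) = (\<lambda>(w, y). y # w) ` (walks n m \<times> {..<n})"
    by (auto simp: walks_def length_Suc_conv image_iff)
  hence "sum f (walks n (Suc m)) = sum (f \<circ> (\<lambda>(w, y). y # w)) (walks n m \<times> {..<n})"
    by (simp add: sum.reindex inj_on_def)
  thus ?thesis by (simp add: sum.cartesian_product comp_def case_prod_unfold)
qed

text \<open>
  Prepending a vertex to a walk either adds a new edge, which costs a row sum of q, or repeats one
  of the at most k edges already present, each of which determines the new vertex.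
\<close>

lemma sum_walks_few_edges_le:
  fixes q :: "nat \<times> nat \<Rightarrow> real"
  assumes q: "\<And>e. e \<in> {(i, j). i \<le> j \<and> j < n} \<Longrightarrow> 0 \<le> q e"
    and s: "\<And>x. x < n \<Longrightarrow> (\<Sum>y<n. q (min y x, max y x)) \<le> s" and s0: "0 \<le> s"
  shows "(\<Sum>w\<in>walks n m. if card (set (walk_edges w)) \<le> k then prod q (set (walk_edges w)) else 0)
           \<le> real n * (s + real k) ^ m"
proof (induction m)
  case 0
  show ?case by (simp add: sum_walks_0)
next
  case (Suc m)
  define g where "g w = (if card (set (walk_edges w)) \<le> k then prod q (set (walk_edges w)) else 0)"
    for w
  have step: "(\<Sum>y<n. g (y # w)) \<le> (s + real k) * g w" if w: "w \<in> walks n m" for w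
  proof -
    define S where "S = set (walk_edges w)"
    define f where "f y = (min y (hd w), max y (hd w))" for y
    have S: "S \<subseteq> {(i, j). i \<le> j \<and> j < n}" unfolding S_def by (rule set_walk_edges[OF w])
    have finS: "finite S" unfolding S_def by simp
    have P0: "0 \<le> prod q S" using S by (intro prod_nonneg) (auto intro!: q)
    have fq: "0 \<le> q (f y)" if "y < n" for y
      using that hd_walk_less[OF w] unfolding f_def by (intro q) (auto simp: max_def min_def)
    have gy: "g (y # w) = (if card (insert (f y) S) \<le> k then prod q (insert (f y) S) else 0)" for y
      unfolding g_def walk_edges_Cons[OF w] f_def S_def by simp
    show ?thesis
    proof (cases "card S \<le> k")
      case False
      have "g (y # w) = 0" for y
        using False card_mono[of "insert (f y) S" S] finS unfolding gy by fastforce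
      thus ?thesis using False by (simp add: g_def S_def)
    next
      case True
      have inj: "inj_on f {y. y < n \<and> f y \<in> S}"
        unfolding inj_on_def f_def by (auto simp: min_def max_def split: if_splits)
      have "card {y. y < n \<and> f y \<in> S} \<le> card S"
        using finS by (intro card_inj_on_le[OF inj]) auto
      hence cnt: "(\<Sum>y<n. of_bool (f y \<in> S) :: real) \<le> real k"
        using True by (simp add: of_bool_def sum.If_cases Int_def)
      have "(\<Sum>y<n. g (y # w)) \<le> (\<Sum>y<n. (q (f y) + of_bool (f y \<in> S)) * prod q S)"
      proof (rule sum_mono)
        fix y assume "y \<in> {..<n}"
        hence fy: "0 \<le> q (f y)" using fq by simp
        show "g (y # w) \<le> (q (f y) + of_bool (f y \<in> S)) * prod q S"
          using True finS P0 fy unfolding gy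
          by (cases "f y \<in> S") (auto simp: insert_absorb distrib_right)
      qed
      also have "\<dots> = ((\<Sum>y<n. q (f y)) + (\<Sum>y<n. of_bool (f y \<in> S))) * prod q S"
        by (simp only: sum_distrib_right[symmetric] sum.distrib)
      also have "\<dots> \<le> (s + real k) * prod q S"
        using s[OF hd_walk_less[OF w]] cnt P0 unfolding f_def
        by (intro mult_right_mono add_mono) auto
      finally show ?thesis using True by (simp add: g_def S_def)
    qed
  qed
  have "sum g (walks n (Suc m)) \<le> (\<Sum>w\<in>walks n m. (s + real k) * g w)"
    unfolding sum_walks_Suc by (intro sum_mono step)
  also have "\<dots> = (s + real k) * sum g (walks n m)" by (simp add: sum_distrib_left)
  also have "\<dots> \<le> (s + real k) * (real n * (s + real k) ^ m)"
    using Suc s0 unfolding g_def by (intro mult_left_mono) auto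
  finally show ?case unfolding g_def by (simp add: mult_ac)
qed

text \<open>With the weights \<open>p\<close> themselves the preceding bound would have base
  \<open>D + k\<close> and exponent \<open>2 * k\<close>, which is too large when \<open>D\<close>
  exceeds \<open>k\<close> by far. A walk with at most \<open>k\<close> distinct edges pays the
  scaling factor at most \<open>k\<close> times.\<close>

lemma sum_walks_repeated_edges_le:
  fixes p :: "nat \<times> nat \<Rightarrow> real"
  assumes p: "\<And>e. e \<in> {(i, j). i \<le> j \<and> j < n} \<Longrightarrow> 0 \<le> p e"
    and D: "\<And>x. x < n \<Longrightarrow> (\<Sum>y<n. p (min y x, max y x)) \<le> D"
    and k: "0 < k" "real k \<le> D"
  shows "(\<Sum>w\<in>walks n (2 * k). if card (set (walk_edges w)) \<le> k then prod p (set (walk_edges w)) else 0)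
           \<le> real n * (4 * D * real k) ^ k"
proof -
  \<comment> \<open>rescaling the weights by \<theta> balances the two terms of the preceding bound\<close>
  define \<theta> where "\<theta> = D / real k"
  have \<theta>: "1 \<le> \<theta>" using k by (simp add: \<theta>_def)
  have "(\<Sum>w\<in>walks n (2 * k). if card (set (walk_edges w)) \<le> k then prod p (set (walk_edges w)) else 0)
     \<le> (\<Sum>w\<in>walks n (2 * k). \<theta> ^ k * (if card (set (walk_edges w)) \<le> k
          then prod (\<lambda>e. p e / \<theta>) (set (walk_edges w)) else 0))"
  proof (rule sum_mono)
    fix w assume w: "w \<in> walks n (2 * k)"
    define S where "S = set (walk_edges w)"
    have P0: "0 \<le> prod p S" unfolding S_def
      using set_walk_edges[OF w] by (intro prod_nonneg) (auto intro!: p)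
    \<comment> \<open>Having fewer than \<open>k\<close> edges is harmless because
      \<open>\<theta>\<close> is at least 1, which is where \<open>real k \<le> D\<close>
      enters.\<close>
    have "prod p S \<le> \<theta> ^ k * prod (\<lambda>e. p e / \<theta>) S" if "card S \<le> k"
    proof -
      have "prod p S * \<theta> ^ card S \<le> prod p S * \<theta> ^ k"
        using P0 \<theta> that by (intro mult_left_mono power_increasing) auto
      thus ?thesis using \<theta> by (simp add: prod_dividef field_simps)
    qed
    thus "(if card (set (walk_edges w)) \<le> k then prod p (set (walk_edges w)) else 0)
      \<le> \<theta> ^ k * (if card (set (walk_edges w)) \<le> k
          then prod (\<lambda>e. p e / \<theta>) (set (walk_edges w)) else 0)"
      unfolding S_def by simp
  qed
  also have "\<dots> \<le> \<theta> ^ k * (real n * (D / \<theta> + real k) ^ (2 * k))"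
    unfolding sum_distrib_left[symmetric]
  proof (intro mult_left_mono sum_walks_few_edges_le)
    fix x assume "x < n"
    thus "(\<Sum>y<n. p (min y x, max y x) / \<theta>) \<le> D / \<theta>"
      using D \<theta> by (simp add: sum_divide_distrib[symmetric] divide_right_mono)
  qed (use p \<theta> k in auto)
  \<comment> \<open>After rescaling, new edges and old edges cost the same, \<open>k\<close>
    each.\<close>
  also have "D / \<theta> + real k = 2 * real k" using k by (simp add: \<theta>_def)
  also have "\<theta> ^ k * (real n * (2 * real k) ^ (2 * k)) = real n * (\<theta> * (2 * real k)\<^sup>2) ^ k"
    by (simp add: power_mult power_mult_distrib)
  also have "\<theta> * (2 * real k)\<^sup>2 = 4 * D * real k"
    using k by (simp add: \<theta>_def power2_eq_square)
  finally show ?thesis .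
qed

text \<open>The power grows by a factor on the right while walks grow at the head. Hence the column
  index is the head of the walk and the row index its last vertex.\<close>

lemma pow_mat_eq_sum_walks:
  fixes x :: "nat \<times> nat \<Rightarrow> real"
  assumes ij: "i < n" "j < n"
  defines "M \<equiv> Matrix.mat n n (\<lambda>(i, j). x (min i j, max i j))"
  shows "(M ^\<^sub>m m) $$ (i, j) =
    (\<Sum>w\<in>walks n m. if last w = i \<and> hd w = j then prod_list (map x (walk_edges w)) else 0)"
  using ij
proof (induction m arbitrary: j)
  case 0
  thus ?case by (auto simp: sum_walks_0 M_def sum.delta' if_distrib cong: if_cong)
next
  case (Suc m)
  have M: "M \<in> carrier_mat n n" unfolding M_def by simp
  let ?f = "\<lambda>w. prod_list (map x (walk_edges w))"
  have "(M ^\<^sub>m Suc m) $$ (i, j) = (\<Sum>l<n. (M ^\<^sub>m m) $$ (i, l) * M $$ (l, j))"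
    using Suc.prems pow_carrier_mat[OF M, of m] M
    by (simp add: scalar_prod_def lessThan_atLeast0)
  also have "\<dots> = (\<Sum>l<n. \<Sum>w\<in>walks n m. (if last w = i \<and> hd w = l then ?f w else 0)
      * x (min l j, max l j))"
    using Suc by (intro sum.cong) (auto simp: M_def sum_distrib_right)
  also have "\<dots> = (\<Sum>w\<in>walks n m. \<Sum>l<n. (if last w = i \<and> hd w = l then ?f w else 0)
      * x (min l j, max l j))" by (rule sum.swap)
  also have "\<dots> = (\<Sum>w\<in>walks n m. if last w = i then x (min j (hd w), max j (hd w)) * ?f w else 0)"
  proof (rule sum.cong[OF refl])
    fix w assume w: "w \<in> walks n m"
    have "(\<Sum>l<n. (if last w = i \<and> hd w = l then ?f w else 0) * x (min l j, max l j))
      = (\<Sum>l<n. if hd w = l then (if last w = i then ?f w * x (min l j, max l j) else 0) else 0)"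
      by (intro sum.cong) auto
    also have "\<dots> = (if last w = i then ?f w * x (min (hd w) j, max (hd w) j) else 0)"
      using hd_walk_less[OF w] by (simp add: sum.delta)
    finally show "(\<Sum>l<n. (if last w = i \<and> hd w = l then ?f w else 0) * x (min l j, max l j))
      = (if last w = i then x (min j (hd w), max j (hd w)) * ?f w else 0)"
      by (simp add: min.commute max.commute mult.commute)
  qed
  also have "\<dots> = (\<Sum>w\<in>walks n m. \<Sum>y<n. if last (y # w) = i \<and> hd (y # w) = j
      then ?f (y # w) else 0)"
  proof (rule sum.cong[OF refl])
    fix w assume w: "w \<in> walks n m"
    hence ne: "w \<noteq> []" by (auto simp: walks_def)
    have "(\<Sum>y<n. if last (y # w) = i \<and> hd (y # w) = j then ?f (y # w) else 0)
      = (\<Sum>y<n. if j = y then (if last w = i then ?f (y # w) else 0) else 0)"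
      using ne by (intro sum.cong) auto
    also have "\<dots> = (if last w = i then ?f (j # w) else 0)"
      using Suc.prems by (simp add: sum.delta)
    finally show "(if last w = i then x (min j (hd w), max j (hd w)) * ?f w else 0)
      = (\<Sum>y<n. if last (y # w) = i \<and> hd (y # w) = j then ?f (y # w) else 0)"
      by (simp add: walk_edges_Cons[OF w])
  qed
  finally show ?case unfolding sum_walks_Suc .
qed

section \<open>The moment method\<close>

text \<open>Independence, one coordinate at a time. Finite supports turn each expectation into a
  finite sum, so no separate integrability argument arises.\<close>

lemma expectation_prod_Pi_pmf_finite:
  fixes f :: "'a \<Rightarrow> 'b \<Rightarrow> real"
  assumes I: "finite I" and fin: "\<And>i. i \<in> I \<Longrightarrow> finite (set_pmf (p i))"
  shows "measure_pmf.expectation (Pi_pmf I d p) (\<lambda>y. \<Prod>i\<in>I. f i (y i)) =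
           (\<Prod>i\<in>I. measure_pmf.expectation (p i) (f i))"
  using assms
proof (induction I rule: finite_induct)
  case empty
  thus ?case by simp
next
  case (insert x I)
  let ?P = "Pi_pmf I d p"
  have fP: "finite (set_pmf ?P)" using insert by (subst set_Pi_pmf) auto
  have fx: "finite (set_pmf (p x))" using insert by auto
  have "measure_pmf.expectation (Pi_pmf (insert x I) d p) (\<lambda>y. \<Prod>i\<in>insert x I. f i (y i))
     = measure_pmf.expectation (pair_pmf (p x) ?P) (\<lambda>(a, y). f x a * (\<Prod>i\<in>I. f i (y i)))"
  proof -
    have "(\<Prod>i\<in>I. f i (if i = x then a else y i)) = (\<Prod>i\<in>I. f i (y i))" for a y
      using insert.hyps by (intro prod.cong) auto
    thus ?thesis using insert.hyps by (simp add: Pi_pmf_insert case_prod_unfold)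
  qed
  also have "\<dots> = (\<Sum>z\<in>set_pmf (p x) \<times> set_pmf ?P.
      pmf (pair_pmf (p x) ?P) z * (case z of (a, y) \<Rightarrow> f x a * (\<Prod>i\<in>I. f i (y i))))"
    using fx fP by (subst integral_measure_pmf[of "set_pmf (p x) \<times> set_pmf ?P"]) auto
  also have "\<dots> = (\<Sum>a\<in>set_pmf (p x). pmf (p x) a * f x a) *
      (\<Sum>y\<in>set_pmf ?P. pmf ?P y * (\<Prod>i\<in>I. f i (y i)))"
    unfolding sum_product sum.cartesian_product
    by (intro sum.cong) (auto simp: pmf_pair mult_ac)
  also have "\<dots> = measure_pmf.expectation (p x) (f x) *
      measure_pmf.expectation ?P (\<lambda>y. \<Prod>i\<in>I. f i (y i))"
    using fx fP by (simp add: integral_measure_pmf[of "set_pmf (p x)"] integral_measure_pmf[of "set_pmf ?P"])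
  also have "measure_pmf.expectation ?P (\<lambda>y. \<Prod>i\<in>I. f i (y i)) =
      (\<Prod>i\<in>I. measure_pmf.expectation (p i) (f i))"
    using insert by auto
  finally show ?case using insert.hyps by simp
qed

lemma expectation_bernoulli_centred_power:
  fixes p :: real
  assumes "0 \<le> p" "p \<le> 1"
  shows "measure_pmf.expectation (bernoulli_pmf p) (\<lambda>v. (of_bool v - p) ^ c) =
      p * (1 - p) ^ c + (1 - p) * (- p) ^ c"
  using assms by (subst integral_measure_pmf[of UNIV]) (auto simp: UNIV_bool)

text \<open>Bounding all these moments by \<open>p\<close> makes the cost of an edge independent of
  how often a walk repeats it.\<close>

lemma abs_bernoulli_centred_moment_le:
  fixes p :: real
  assumes p: "0 \<le> p" "p \<le> 1" and c: "2 \<le> c"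
  shows "\<bar>measure_pmf.expectation (bernoulli_pmf p) (\<lambda>v. (of_bool v - p) ^ c)\<bar> \<le> p"
proof -
  have "(1 - p) ^ c \<le> (1 - p) ^ 1" "p ^ c \<le> p ^ 2"
    using p c by (intro power_decreasing; simp)+
  hence "p * (1 - p) ^ c + (1 - p) * p ^ c \<le> p * (1 - p) + (1 - p) * p\<^sup>2"
    using p by (intro add_mono mult_left_mono) auto
  also have "\<dots> = p - p ^ 3"
    by (simp add: algebra_simps power2_eq_square power3_eq_cube)
  also have "\<dots> \<le> p" using p by simp
  finally have "p * (1 - p) ^ c + (1 - p) * p ^ c \<le> p" .
  moreover have "\<bar>p * (1 - p) ^ c + (1 - p) * (- p) ^ c\<bar> \<le> p * (1 - p) ^ c + (1 - p) * p ^ c"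
    using p by (intro order.trans[OF abs_triangle_ineq]) (simp add: abs_mult power_abs)
  ultimately show ?thesis unfolding expectation_bernoulli_centred_power[OF p] by linarith
qed

lemma prod_list_map_eq_prod_count:
  fixes x :: "'a \<Rightarrow> 'b :: comm_monoid_mult"
  assumes "finite I" "set es \<subseteq> I"
  shows "prod_list (map x es) = (\<Prod>e\<in>I. x e ^ count_list es e)"
  using assms(2)
proof (induction es)
  case (Cons a es)
  have "(\<Prod>e\<in>I. x e ^ count_list (a # es) e) =
      (\<Prod>e\<in>I. (if e = a then x e else 1) * x e ^ count_list es e)"
    by (intro prod.cong) auto
  also have "\<dots> = x a * (\<Prod>e\<in>I. x e ^ count_list es e)"
    using Cons.prems assms(1) by (simp add: prod.distrib prod.delta)
  finally show ?case using Cons by simp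
qed simp

text \<open>By independence the expectation factorises over distinct edges. An edge used exactly
  once contributes a centred mean, which is zero; otherwise each edge is used at least twice, so
  \<open>2 * k\<close> steps involve at most \<open>k\<close> edges.\<close>

lemma abs_expectation_prod_edges_le:
  fixes p :: "'a \<Rightarrow> real"
  assumes I: "finite I" and p: "\<And>e. e \<in> I \<Longrightarrow> 0 \<le> p e \<and> p e \<le> 1"
    and es: "set es \<subseteq> I" "length es = 2 * k"
  shows "\<bar>measure_pmf.expectation (Pi_pmf I False (\<lambda>e. bernoulli_pmf (p e)))
            (\<lambda>E. prod_list (map (\<lambda>e. of_bool (E e) - p e) es))\<bar>
         \<le> (if card (set es) \<le> k then prod p (set es) else 0)"
proof -
  let ?c = "count_list es"
  let ?m = "\<lambda>e. measure_pmf.expectation (bernoulli_pmf (p e)) (\<lambda>v. (of_bool v - p e) ^ ?c e)"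
  have eq: "measure_pmf.expectation (Pi_pmf I False (\<lambda>e. bernoulli_pmf (p e)))
            (\<lambda>E. prod_list (map (\<lambda>e. of_bool (E e) - p e) es)) = (\<Prod>e\<in>I. ?m e)"
    unfolding prod_list_map_eq_prod_count[OF I es(1)]
    by (rule expectation_prod_Pi_pmf_finite[OF I, of _ _ "\<lambda>e v. (of_bool v - p e) ^ ?c e"]) simp
  have P0: "0 \<le> prod p (set es)" using es p by (intro prod_nonneg) auto
  show ?thesis
  proof (cases "\<exists>e\<in>set es. ?c e = 1")
    case True
    then obtain e where e: "e \<in> set es" "?c e = 1" by blast
    hence "?m e = 0" using p[of e] es e by (subst expectation_bernoulli_centred_power) auto
    hence "(\<Prod>e\<in>I. ?m e) = 0" using e(1) es(1) by (intro prod_zero[OF I] bexI[of _ e]) auto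
    thus ?thesis using P0 by (simp add: eq)
  next
    case False
    have c2: "2 \<le> ?c e" if "e \<in> set es" for e
    proof -
      have "?c e \<noteq> 0" using that by (simp add: count_list_0_iff)
      moreover have "?c e \<noteq> 1" using False that by blast
      ultimately show ?thesis by linarith
    qed
    have "2 * card (set es) = (\<Sum>e\<in>set es. 2)" by simp
    also have "\<dots> \<le> (\<Sum>e\<in>set es. ?c e)" using c2 by (intro sum_mono)
    also have "\<dots> = 2 * k" using es by (simp add: sum_count_set)
    finally have card: "card (set es) \<le> k" by simp
    \<comment> \<open>Coins outside the list appear with exponent 0 and contribute 1.\<close>
    have "(\<Prod>e\<in>I. ?m e) = (\<Prod>e\<in>set es. ?m e)"
      using I es by (intro prod.mono_neutral_right) (auto simp: count_list_0_iff)
    hence "\<bar>\<Prod>e\<in>I. ?m e\<bar> = (\<Prod>e\<in>set es. \<bar>?m e\<bar>)" by (simp add: abs_prod)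
    also have "\<dots> \<le> prod p (set es)"
      using p es c2 by (intro prod_mono conjI abs_ge_zero abs_bernoulli_centred_moment_le) auto
    finally show ?thesis using card by (simp add: eq)
  qed
qed

text \<open>This is the matrix X of the overview, written in terms of the coins \<open>E\<close>;
  its expectation is zero when \<open>p\<close> gives their probabilities.\<close>

definition noise_mat :: "nat \<Rightarrow> (nat \<times> nat \<Rightarrow> real) \<Rightarrow> (nat \<times> nat \<Rightarrow> bool) \<Rightarrow> real mat" where
  "noise_mat n p E = Matrix.mat n n
     (\<lambda>(i, j). of_bool (E (min i j, max i j)) - p (min i j, max i j))"

lemma expectation_trace_noise_mat_le:
  fixes n k :: nat and p :: "nat \<times> nat \<Rightarrow> real" and D :: real
  defines "I \<equiv> {(i, j). i \<le> j \<and> j < n}"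
  assumes p: "\<And>e. e \<in> I \<Longrightarrow> 0 \<le> p e \<and> p e \<le> 1"
    and D: "\<And>x. x < n \<Longrightarrow> (\<Sum>y<n. p (min y x, max y x)) \<le> D"
    and k: "0 < k" "real k \<le> D"
  shows "measure_pmf.expectation (Pi_pmf I False (\<lambda>e. bernoulli_pmf (p e)))
            (\<lambda>E. \<Sum>i<n. (noise_mat n p E ^\<^sub>m (2 * k)) $$ (i, i))
         \<le> real n * (4 * D * real k) ^ k"
proof -
  have "I \<subseteq> {..<n} \<times> {..<n}" by (auto simp: I_def)
  hence I: "finite I" by (rule finite_subset) simp
  let ?P = "Pi_pmf I False (\<lambda>e. bernoulli_pmf (p e))"
  have fP: "finite (set_pmf ?P)" using I by (subst set_Pi_pmf) auto
  let ?f = "\<lambda>E w. prod_list (map (\<lambda>e. of_bool (E e) - p e) (walk_edges w))"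
  have tr: "(\<Sum>i<n. (noise_mat n p E ^\<^sub>m (2 * k)) $$ (i, i)) =
      (\<Sum>w\<in>walks n (2 * k). if last w = hd w then ?f E w else 0)" for E
  proof -
    have "(\<Sum>i<n. (noise_mat n p E ^\<^sub>m (2 * k)) $$ (i, i)) =
      (\<Sum>i<n. \<Sum>w\<in>walks n (2 * k). if last w = i \<and> hd w = i then ?f E w else 0)"
      unfolding noise_mat_def
      by (intro sum.cong refl pow_mat_eq_sum_walks[where x = "\<lambda>e. of_bool (E e) - p e"]) auto
    also have "\<dots> = (\<Sum>w\<in>walks n (2 * k). \<Sum>i<n. if last w = i \<and> hd w = i then ?f E w else 0)"
      by (rule sum.swap)
    also have "\<dots> = (\<Sum>w\<in>walks n (2 * k). if last w = hd w then ?f E w else 0)"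
    proof (rule sum.cong[OF refl])
      fix w assume w: "w \<in> walks n (2 * k)"
      have "(\<Sum>i<n. if last w = i \<and> hd w = i then ?f E w else 0) =
        (\<Sum>i<n. if i = hd w then (if last w = i then ?f E w else 0) else 0)"
        by (intro sum.cong) auto
      thus "(\<Sum>i<n. if last w = i \<and> hd w = i then ?f E w else 0) =
        (if last w = hd w then ?f E w else 0)"
        using hd_walk_less[OF w] by (simp add: sum.delta)
    qed
    finally show ?thesis .
  qed
  have "measure_pmf.expectation ?P (\<lambda>E. \<Sum>w\<in>walks n (2 * k). if last w = hd w then ?f E w else 0)
    = (\<Sum>w\<in>walks n (2 * k). measure_pmf.expectation ?P (\<lambda>E. if last w = hd w then ?f E w else 0))"
    by (intro Bochner_Integration.integral_sum integrable_measure_pmf_finite fP)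
  \<comment> \<open>The closing condition \<open>last w = hd w\<close> is dropped from here on; open
    walks only add nonnegative terms to the bound.\<close>
  also have "\<dots> \<le> (\<Sum>w\<in>walks n (2 * k). if card (set (walk_edges w)) \<le> k
      then prod p (set (walk_edges w)) else 0)"
  proof (rule sum_mono)
    fix w assume w: "w \<in> walks n (2 * k)"
    have "\<bar>measure_pmf.expectation ?P (\<lambda>E. ?f E w)\<bar> \<le> (if card (set (walk_edges w)) \<le> k
      then prod p (set (walk_edges w)) else 0)"
      using set_walk_edges[OF w] length_walk_edges[OF w] unfolding I_def[symmetric]
      by (intro abs_expectation_prod_edges_le I p)
    thus "measure_pmf.expectation ?P (\<lambda>E. if last w = hd w then ?f E w else 0)
      \<le> (if card (set (walk_edges w)) \<le> k then prod p (set (walk_edges w)) else 0)"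
      by (cases "last w = hd w") auto
  qed
  also have "\<dots> \<le> real n * (4 * D * real k) ^ k"
    using p D k unfolding I_def by (intro sum_walks_repeated_edges_le) auto
  finally show ?thesis unfolding tr .
qed

section \<open>From the trace of an even power to the quadratic form\<close>

lemma pow_mat_add:
  fixes X :: "real mat"
  assumes X: "X \<in> carrier_mat n n"
  shows "X ^\<^sub>m (a + b) = X ^\<^sub>m a * X ^\<^sub>m b"
proof (induction b)
  case 0
  thus ?case using X by simp
next
  case (Suc b)
  thus ?case
    using X assoc_mult_mat[OF pow_carrier_mat[OF X] pow_carrier_mat[OF X] X, of a b] by simp
qed

lemma transpose_pow_mat_symmetric:
  fixes X :: "real mat"
  assumes X: "X \<in> carrier_mat n n" and sym: "X\<^sup>T = X"
  shows "(X ^\<^sub>m m)\<^sup>T = X ^\<^sub>m m"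
proof (induction m)
  case 0
  thus ?case using X by simp
next
  case (Suc m)
  have "(X ^\<^sub>m Suc m)\<^sup>T = X * X ^\<^sub>m m"
    using Suc sym transpose_mult[OF pow_carrier_mat[OF X] X, of m] by simp
  also have "\<dots> = X ^\<^sub>m Suc m" using pow_mat_add[OF X, of 1 m] X by simp
  finally show ?case .
qed

text \<open>Repeated squaring: with \<open>Y\<close> symmetric, the squared norm of
  \<open>Y *\<^sub>v u\<close> is the inner product of \<open>u\<close> with
  \<open>Y *\<^sub>v (Y *\<^sub>v u)\<close>, and Cauchy-Schwarz bounds it by the norm of the
  latter. This is why exponents are powers of two.\<close>

lemma norm_pow_symmetric_le:
  fixes X :: "real mat"
  assumes X: "X \<in> carrier_mat n n" and sym: "X\<^sup>T = X"
    and u: "u \<in> carrier_vec n" "u \<bullet> u = 1"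
  shows "((X *\<^sub>v u) \<bullet> (X *\<^sub>v u)) ^ (2 ^ r) \<le> (X ^\<^sub>m (2 ^ r) *\<^sub>v u) \<bullet> (X ^\<^sub>m (2 ^ r) *\<^sub>v u)"
proof (induction r)
  case 0
  thus ?case using X by simp
next
  case (Suc r)
  define Y where "Y = X ^\<^sub>m (2 ^ r)"
  have Y: "Y \<in> carrier_mat n n" "Y\<^sup>T = Y"
    unfolding Y_def by (auto intro: pow_carrier_mat X transpose_pow_mat_symmetric[OF X sym])
  have Yu: "Y *\<^sub>v u \<in> carrier_vec n" using Y u by simp
  have YY: "X ^\<^sub>m (2 ^ Suc r) *\<^sub>v u = Y *\<^sub>v (Y *\<^sub>v u)"
    using pow_mat_add[OF X, of "2 ^ r" "2 ^ r"] Y u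
    by (simp add: mult_2 Y_def[symmetric] assoc_mult_mat_vec[of _ n n _ n])
  have "((X *\<^sub>v u) \<bullet> (X *\<^sub>v u)) ^ (2 ^ Suc r) = (((X *\<^sub>v u) \<bullet> (X *\<^sub>v u)) ^ (2 ^ r))\<^sup>2"
    by (simp add: power_mult[symmetric] mult.commute)
  also have "\<dots> \<le> ((Y *\<^sub>v u) \<bullet> (Y *\<^sub>v u))\<^sup>2"
    using Suc unfolding Y_def by (intro power_mono zero_le_power scalar_prod_self_nonneg)
  also have "(Y *\<^sub>v u) \<bullet> (Y *\<^sub>v u) = u \<bullet> (Y *\<^sub>v (Y *\<^sub>v u))"
    by (rule scalar_prod_symmetric_mat[OF Y u(1) Yu])
  also have "\<dots>\<^sup>2 \<le> (Y *\<^sub>v (Y *\<^sub>v u)) \<bullet> (Y *\<^sub>v (Y *\<^sub>v u))"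
    using scalar_prod_Cauchy_Schwarz[of u n "Y *\<^sub>v (Y *\<^sub>v u)"] u Y by simp
  finally show ?case unfolding YY .
qed

lemma trace_square_symmetric:
  fixes Y :: "real mat"
  assumes Y: "Y \<in> carrier_mat n n" "Y\<^sup>T = Y"
  shows "(\<Sum>i<n. (Y * Y) $$ (i, i)) = (\<Sum>i<n. \<Sum>j<n. (Y $$ (i, j))\<^sup>2)"
proof (intro sum.cong refl)
  fix i assume i: "i \<in> {..<n}"
  have "Y $$ (j, i) = Y $$ (i, j)" if "j < n" for j
    using arg_cong[OF Y(2), of "\<lambda>M. M $$ (i, j)"] i that Y(1) by simp
  thus "(Y * Y) $$ (i, i) = (\<Sum>j<n. (Y $$ (i, j))\<^sup>2)"
    using i Y(1) by (simp add: scalar_prod_sum[of _ n] power2_eq_square)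
qed

lemma norm_mult_le_frobenius:
  fixes Y :: "real mat"
  assumes Y: "Y \<in> carrier_mat n n" and u: "u \<in> carrier_vec n" "u \<bullet> u = 1"
  shows "(Y *\<^sub>v u) \<bullet> (Y *\<^sub>v u) \<le> (\<Sum>i<n. \<Sum>j<n. (Y $$ (i, j))\<^sup>2)"
proof -
  have "(Y *\<^sub>v u) \<bullet> (Y *\<^sub>v u) = (\<Sum>i<n. (Matrix.row Y i \<bullet> u)\<^sup>2)"
    using Y u by (subst scalar_prod_sum[of _ n]) (auto simp: power2_eq_square)
  also have "\<dots> \<le> (\<Sum>i<n. \<Sum>j<n. (Y $$ (i, j))\<^sup>2)"
  proof (rule sum_mono)
    fix i assume i: "i \<in> {..<n}"
    have r: "Matrix.row Y i \<in> carrier_vec n" using Y by (intro carrier_vecI) simp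
    have "(Matrix.row Y i \<bullet> u)\<^sup>2 \<le> Matrix.row Y i \<bullet> Matrix.row Y i"
      using scalar_prod_Cauchy_Schwarz[OF r u(1)] u(2) by simp
    thus "(Matrix.row Y i \<bullet> u)\<^sup>2 \<le> (\<Sum>j<n. (Y $$ (i, j))\<^sup>2)"
      using i r Y by (simp add: scalar_prod_sum[of _ n] power2_eq_square)
  qed
  finally show ?thesis .
qed

lemma trace_even_pow_symmetric:
  fixes X :: "real mat"
  assumes X: "X \<in> carrier_mat n n" and sym: "X\<^sup>T = X"
  shows "(\<Sum>i<n. (X ^\<^sub>m (2 * k)) $$ (i, i)) = (\<Sum>i<n. \<Sum>j<n. ((X ^\<^sub>m k) $$ (i, j))\<^sup>2)"
  using trace_square_symmetric[OF pow_carrier_mat[OF X] transpose_pow_mat_symmetric[OF X sym]]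
    pow_mat_add[OF X, of k k] by (simp add: mult_2)

text \<open>The trace of the even power is the squared Frobenius norm of
  \<open>X ^\<^sub>m k\<close>, which dominates the squared norm of its value at any unit vector.
  One number thus controls all \<open>u\<close> at once.\<close>

lemma quadratic_form_pow_le_trace:
  fixes X :: "real mat"
  assumes X: "X \<in> carrier_mat n n" and sym: "X\<^sup>T = X"
    and u: "u \<in> carrier_vec n" "u \<bullet> u = 1" and k: "k = 2 ^ r"
  shows "((u \<bullet> (X *\<^sub>v u))\<^sup>2) ^ k \<le> (\<Sum>i<n. (X ^\<^sub>m (2 * k)) $$ (i, i))"
proof -
  have "(u \<bullet> (X *\<^sub>v u))\<^sup>2 \<le> (X *\<^sub>v u) \<bullet> (X *\<^sub>v u)"
    using scalar_prod_Cauchy_Schwarz[of u n "X *\<^sub>v u"] u X by simp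
  hence "((u \<bullet> (X *\<^sub>v u))\<^sup>2) ^ k \<le> ((X *\<^sub>v u) \<bullet> (X *\<^sub>v u)) ^ k"
    by (intro power_mono) auto
  also have "\<dots> \<le> (X ^\<^sub>m k *\<^sub>v u) \<bullet> (X ^\<^sub>m k *\<^sub>v u)"
    unfolding k by (rule norm_pow_symmetric_le[OF X sym u])
  also have "\<dots> \<le> (\<Sum>i<n. \<Sum>j<n. ((X ^\<^sub>m k) $$ (i, j))\<^sup>2)"
    by (rule norm_mult_le_frobenius[OF pow_carrier_mat[OF X] u])
  finally show ?thesis unfolding trace_even_pow_symmetric[OF X sym] .
qed

lemma power_of_two_between:
  fixes L :: real
  assumes "1 / 2 \<le> L"
  shows "\<exists>r. L \<le> real (2 ^ r) \<and> real (2 ^ r) \<le> 2 * L"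
proof -
  define r where "r = (LEAST r. L \<le> real (2 ^ r))"
  obtain r0 where "L < 2 ^ r0" using real_arch_pow[of 2 L] by auto
  hence "\<exists>r. L \<le> real (2 ^ r)" by (intro exI[of _ r0]) auto
  hence r: "L \<le> real (2 ^ r)" unfolding r_def by (rule LeastI_ex)
  have "real (2 ^ r) \<le> 2 * L"
  proof (cases r)
    \<comment> \<open>The least power is then 1, and \<open>1 / 2 \<le> L\<close> gives
      \<open>1 \<le> 2 * L\<close>.\<close>
    case 0
    thus ?thesis using assms by simp
  next
    case (Suc s)
    hence "\<not> L \<le> real (2 ^ s)" unfolding r_def by (metis lessI not_less_Least)
    thus ?thesis using Suc by simp
  qed
  thus ?thesis using r by blast
qed

text \<open>Markov's inequality for the trace of the \<open>2 * k\<close>-th power. Since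
  \<open>k\<close> is at least \<open>L\<close>, the factor \<open>n\<close> from the trace is
  absorbed into a \<open>k\<close>-th power.\<close>

lemma noise_mat_concentration:
  fixes p :: "nat \<times> nat \<Rightarrow> real" and n :: nat and d \<delta> :: real
  defines "I \<equiv> {(i, j). i \<le> j \<and> j < n}" and "L \<equiv> ln (2 * real n / \<delta>)"
  assumes n: "0 < n" and \<delta>: "0 < \<delta>" "\<delta> < 1"
    and p: "\<And>e. e \<in> I \<Longrightarrow> 0 \<le> p e \<and> p e \<le> 1"
    and deg: "\<And>x. x < n \<Longrightarrow> (\<Sum>y<n. p (min y x, max y x)) \<le> d"
    and d: "4 / 9 * L \<le> d"
  shows "measure_pmf.prob (Pi_pmf I False (\<lambda>e. bernoulli_pmf (p e)))
     {E. \<forall>u\<in>carrier_vec n. u \<bullet> u = 1 \<longrightarrow> \<bar>u \<bullet> (noise_mat n p E *\<^sub>v u)\<bar> \<le> 16 * sqrt (d * L)}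
     \<ge> 1 - \<delta>"
proof -
  let ?P = "Pi_pmf I False (\<lambda>e. bernoulli_pmf (p e))"
  have big: "2 \<le> 2 * real n / \<delta>" using n \<delta> by (simp add: field_simps)
  \<comment> \<open>This is \<open>ln x \<le> x - 1\<close> at \<open>x = 1 / 2\<close>.\<close>
  have "1 / 2 \<le> ln (2 :: real)" using ln_le_minus_one[of "1 / 2"] by (simp add: ln_div)
  also have "\<dots> \<le> L" unfolding L_def using big by simp
  finally have L: "1 / 2 \<le> L" .
  obtain r where r: "L \<le> real (2 ^ r)" "real (2 ^ r) \<le> 2 * L"
    using power_of_two_between[OF L] by blast
  define k :: nat where "k = 2 ^ r"
  have k: "0 < k" "L \<le> real k" "real k \<le> 2 * L" using r by (auto simp: k_def)
  have d0: "0 < d" using d L by linarith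
  define T where "T E = (\<Sum>i<n. (noise_mat n p E ^\<^sub>m (2 * k)) $$ (i, i))" for E
  \<comment> \<open>256 is the square of 16: a \<open>k\<close>-th root and a square root of
    \<open>t\<close> give the stated bound.\<close>
  define t where "t = (256 * (d * L)) ^ k"
  have t0: "0 < t" unfolding t_def using d0 L by simp
  have X: "noise_mat n p E \<in> carrier_mat n n" "(noise_mat n p E)\<^sup>T = noise_mat n p E" for E
    by (auto simp: noise_mat_def min.commute max.commute intro!: eq_matI)
  have T0: "0 \<le> T E" for E
    unfolding T_def trace_even_pow_symmetric[OF X] by (intro sum_nonneg) auto
  have "I \<subseteq> {..<n} \<times> {..<n}" by (auto simp: I_def)
  hence I: "finite I" by (rule finite_subset) simp
  have fP: "finite (set_pmf ?P)" using I by (subst set_Pi_pmf) auto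
  have "measure_pmf.expectation ?P T \<le> real n * (4 * (5 * d) * real k) ^ k"
    unfolding T_def I_def
  proof (rule expectation_trace_noise_mat_le)
    show "(\<Sum>y<n. p (min y x, max y x)) \<le> 5 * d" if "x < n" for x
      using deg[OF that] d0 by linarith
    \<comment> \<open>\<open>k\<close> is at most \<open>2 * L\<close>, hence at most
      \<open>9 / 2 * d\<close>; the factor 5 makes room for this.\<close>
    show "real k \<le> 5 * d" using k d by linarith
  qed (use p k in \<open>auto simp: I_def\<close>)
  \<comment> \<open>By the choice of \<open>L\<close>, \<open>\<delta> * exp L\<close> is
    \<open>2 * n\<close>.\<close>
  also have "\<dots> \<le> \<delta> * exp L * (4 * (5 * d) * (2 * L)) ^ k"
    using k d0 \<delta> n big by (intro mult_mono power_mono) (auto simp: L_def)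
  also have "\<dots> \<le> \<delta> * exp (real k) * (40 * (d * L)) ^ k"
    using k d0 L \<delta> by (intro mult_mono) (auto simp: mult_ac)
  also have "\<dots> = \<delta> * (exp 1 * (40 * (d * L))) ^ k"
    by (simp add: power_mult_distrib exp_of_nat_mult[symmetric])
  also have "\<dots> \<le> \<delta> * t"
  proof -
    have "exp 1 * (40 * (d * L)) \<le> 3 * (40 * (d * L))"
      using exp_le d0 L by (intro mult_right_mono) auto
    also have "\<dots> \<le> 256 * (d * L)" using d0 L by simp
    finally show ?thesis unfolding t_def using d0 L \<delta>
      by (intro mult_left_mono power_mono) auto
  qed
  finally have ET: "measure_pmf.expectation ?P T \<le> \<delta> * t" .
  have "measure_pmf.prob ?P {E \<in> space (measure_pmf ?P). t \<le> T E} \<le> measure_pmf.expectation ?P T / t"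
    using T0 t0 by (intro integral_Markov_inequality_measure[where A = UNIV] integrable_measure_pmf_finite fP) auto
  also have "\<dots> \<le> \<delta>" using ET t0 by (simp add: field_simps)
  finally have bad: "measure_pmf.prob ?P {E. t \<le> T E} \<le> \<delta>" by simp
  have "1 - \<delta> \<le> measure_pmf.prob ?P (- {E. t \<le> T E})"
    using bad measure_pmf.prob_compl[of "{E. t \<le> T E}" ?P] by (simp add: Compl_eq_Diff_UNIV)
  also have "\<dots> \<le> measure_pmf.prob ?P
     {E. \<forall>u\<in>carrier_vec n. u \<bullet> u = 1 \<longrightarrow> \<bar>u \<bullet> (noise_mat n p E *\<^sub>v u)\<bar> \<le> 16 * sqrt (d * L)}"
  proof (intro measure_pmf.finite_measure_mono subsetI CollectI ballI impI)
    fix E and u :: "real Matrix.vec"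
    assume E: "E \<in> - {E. t \<le> T E}" and u: "u \<in> carrier_vec n" "u \<bullet> u = 1"
    have "((u \<bullet> (noise_mat n p E *\<^sub>v u))\<^sup>2) ^ k \<le> T E"
      unfolding T_def by (rule quadratic_form_pow_le_trace[OF X u k_def])
    also have "\<dots> \<le> (256 * (d * L)) ^ k" using E by (simp add: t_def)
    finally have "(u \<bullet> (noise_mat n p E *\<^sub>v u))\<^sup>2 \<le> 256 * (d * L)"
      using k d0 L by (subst (asm) power_mono_iff) auto
    hence "sqrt ((u \<bullet> (noise_mat n p E *\<^sub>v u))\<^sup>2) \<le> sqrt (256 * (d * L))"
      by (rule real_sqrt_le_mono)
    thus "\<bar>u \<bullet> (noise_mat n p E *\<^sub>v u)\<bar> \<le> 16 * sqrt (d * L)"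
      by (simp add: real_sqrt_mult)
  qed auto
  finally show ?thesis .
qed

section \<open>Welfare in an eigenbasis\<close>

context spectral_frame begin

lemma coord_resolvent:
  assumes y: "y \<in> carrier_vec n" and i: "i < n"
  shows "coord ((1\<^sub>m n - \<beta> \<cdot>\<^sub>m A) *\<^sub>v y) $ i = (1 - \<beta> * \<mu> i) * coord y $ i"
proof -
  have "(1\<^sub>m n - \<beta> \<cdot>\<^sub>m A) *\<^sub>v y = y + (- \<beta>) \<cdot>\<^sub>v (A *\<^sub>v y)"
    using y A by (intro eq_vecI) (auto simp: minus_mult_distrib_mat_vec[of _ n n])
  hence "coord ((1\<^sub>m n - \<beta> \<cdot>\<^sub>m A) *\<^sub>v y) = coord y + (- \<beta>) \<cdot>\<^sub>v coord (A *\<^sub>v y)"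
    unfolding coord_def using y A Q
    by (simp add: mult_add_distrib_mat_vec[of _ n n] mult_mat_vec[of _ n n])
  thus ?thesis using i y by (simp add: coord_mult algebra_simps)
qed

text \<open>In coordinates the matrix is diagonal with positive entries, hence injective. Its
  determinant is then nonzero, so \<open>mat_inverse\<close> returns a value and \<open>the\<close>
  is meaningful.\<close>

lemma resolvent_inverse:
  assumes \<mu>: "\<And>i. i < n \<Longrightarrow> \<beta> * \<mu> i < 1"
  defines "B \<equiv> the (mat_inverse (1\<^sub>m n - \<beta> \<cdot>\<^sub>m A))"
  shows "B \<in> carrier_mat n n"
    and "\<And>x i. x \<in> carrier_vec n \<Longrightarrow> i < n \<Longrightarrow> coord (B *\<^sub>v x) $ i = coord x $ i / (1 - \<beta> * \<mu> i)"
proof -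
  define M where "M = 1\<^sub>m n - \<beta> \<cdot>\<^sub>m A"
  have M: "M \<in> carrier_mat n n" using A by (simp add: M_def minus_carrier_mat)
  have "Determinant.det M \<noteq> 0"
  proof
    assume "Determinant.det M = 0"
    then obtain y where y: "y \<in> carrier_vec n" "y \<noteq> 0\<^sub>v n" "M *\<^sub>v y = 0\<^sub>v n"
      using det_0_iff_vec_prod_zero[OF M] by blast
    have z: "coord (0\<^sub>v n) $ i = 0" if "i < n" for i
      using that Q unfolding coord_def by simp
    have "coord y = coord (0\<^sub>v n)"
    proof (rule eq_vecI)
      fix i assume "i < dim_vec (coord (0\<^sub>v n))"
      hence i: "i < n" by simp
      show "coord y $ i = coord (0\<^sub>v n) $ i"
        using coord_resolvent[OF y(1) i, of \<beta>] y(3) \<mu>[OF i] z[OF i] by (simp add: M_def)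
    qed simp
    hence "y = 0\<^sub>v n" by (rule coord_inj[OF y(1) zero_carrier_vec])
    thus False using y by simp
  qed
  hence "M \<in> Units (ring_mat TYPE(real) n ())" by (rule det_non_zero_imp_unit[OF M])
  then obtain B' where "mat_inverse M = Some B'"
    using mat_inverse(1)[OF M, where b = "()"] by (cases "mat_inverse M") auto
  hence B: "mat_inverse M = Some B" by (simp add: B_def M_def)
  show Bc: "B \<in> carrier_mat n n" using mat_inverse(2)[OF M B] by simp
  fix x :: "real Matrix.vec" and i assume x: "x \<in> carrier_vec n" and i: "i < n"
  have "M *\<^sub>v (B *\<^sub>v x) = (M * B) *\<^sub>v x"
    using M Bc x by (simp add: assoc_mult_mat_vec[of _ n n _ n])
  also have "\<dots> = x" using mat_inverse(2)[OF M B] x by simp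
  finally have "coord x $ i = (1 - \<beta> * \<mu> i) * coord (B *\<^sub>v x) $ i"
    using coord_resolvent[of "B *\<^sub>v x" i \<beta>] Bc x i by (simp add: M_def)
  thus "coord (B *\<^sub>v x) $ i = coord x $ i / (1 - \<beta> * \<mu> i)" using \<mu>[OF i] by simp
qed

text \<open>In coordinates welfare is a weighted sum of squares whose largest weight is at index 0.
  Using this weight everywhere gives the upper bound; keeping only the top coordinate gives the
  lower one.\<close>

lemma welfare_bounds:
  assumes \<beta>: "0 < \<beta>" and \<mu>: "\<And>i. i < n \<Longrightarrow> \<beta> * \<mu> i < 1"
    and b: "b \<in> carrier_vec n" and y: "y \<in> carrier_vec n"
  shows "welfare n \<beta> A b y \<le> ((b + y) \<bullet> (b + y)) / (2 * (1 - \<beta> * \<mu> 0)\<^sup>2)"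
    and "(col Q 0 \<bullet> (b + y))\<^sup>2 / (2 * (1 - \<beta> * \<mu> 0)\<^sup>2) \<le> welfare n \<beta> A b y"
proof -
  define B where "B = the (mat_inverse (1\<^sub>m n - \<beta> \<cdot>\<^sub>m A))"
  define x where "x = b + y"
  have x: "x \<in> carrier_vec n" using b y by (simp add: x_def)
  have Bx: "B *\<^sub>v x \<in> carrier_vec n"
    using resolvent_inverse(1)[OF \<mu>, folded B_def] x by simp
  have W: "welfare n \<beta> A b y = (\<Sum>i<n. (coord x $ i)\<^sup>2 / (1 - \<beta> * \<mu> i)\<^sup>2) / 2"
    unfolding welfare_def Let_def B_def[symmetric] x_def[symmetric] vnorm_squared norm_coord[OF Bx]
    by (simp add: resolvent_inverse(2)[OF \<mu> x, folded B_def] power_divide)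
  have "(\<Sum>i<n. (coord x $ i)\<^sup>2 / (1 - \<beta> * \<mu> i)\<^sup>2) \<le> (\<Sum>i<n. (coord x $ i)\<^sup>2 / (1 - \<beta> * \<mu> 0)\<^sup>2)"
  proof (rule sum_mono)
    fix i assume "i \<in> {..<n}"
    hence "0 < 1 - \<beta> * \<mu> 0" "1 - \<beta> * \<mu> 0 \<le> 1 - \<beta> * \<mu> i"
      using \<mu>[OF n_pos] top[of i] \<beta> by auto
    thus "(coord x $ i)\<^sup>2 / (1 - \<beta> * \<mu> i)\<^sup>2 \<le> (coord x $ i)\<^sup>2 / (1 - \<beta> * \<mu> 0)\<^sup>2"
      by (intro divide_left_mono power_mono mult_pos_pos zero_less_power) auto
  qed
  thus "welfare n \<beta> A b y \<le> ((b + y) \<bullet> (b + y)) / (2 * (1 - \<beta> * \<mu> 0)\<^sup>2)"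
    unfolding W x_def[symmetric] norm_coord[OF x] by (simp add: sum_divide_distrib[symmetric])
  have "(coord x $ 0)\<^sup>2 / (1 - \<beta> * \<mu> 0)\<^sup>2 \<le> (\<Sum>i<n. (coord x $ i)\<^sup>2 / (1 - \<beta> * \<mu> i)\<^sup>2)"
    using n_pos by (intro member_le_sum) auto
  thus "(col Q 0 \<bullet> (b + y))\<^sup>2 / (2 * (1 - \<beta> * \<mu> 0)\<^sup>2) \<le> welfare n \<beta> A b y"
    unfolding W x_def[symmetric] coord_top[OF x, symmetric] by simp
qed

text \<open>The common factor \<open>g\<close> of the two welfare bounds cancels, and Cauchy-Schwarz
  bounds the norm of \<open>b + x\<close> by \<open>vnorm b + s\<close>. The condition
  \<open>ne\<close> makes the optimum positive, so that dividing by it preserves the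
  inequalities.\<close>

lemma competitive_ratio_ge:
  assumes \<beta>: "0 < \<beta>" and \<mu>: "\<And>i. i < n \<Longrightarrow> \<beta> * \<mu> i < 1"
    and b: "b \<in> carrier_vec n" and v: "v \<in> carrier_vec n" "v \<bullet> v = 1" and s: "0 < s"
    and ne: "col Q 0 \<bullet> b + s * (col Q 0 \<bullet> v) \<noteq> 0"
  shows "((col Q 0 \<bullet> b + s * (col Q 0 \<bullet> v)) / (vnorm b + s))\<^sup>2
           \<le> competitive_ratio n \<beta> A b (s\<^sup>2) (s \<cdot>\<^sub>v v)"
proof -
  define g where "g = 2 * (1 - \<beta> * \<mu> 0)\<^sup>2"
  have g: "0 < g" using \<mu>[OF n_pos] by (simp add: g_def)
  define W where "W = welfare n \<beta> A b"
  define S where "S = {W x | x. x \<in> carrier_vec n \<and> vnorm x = sqrt (s\<^sup>2)}"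
  define a where "a = col Q 0 \<bullet> b + s * (col Q 0 \<bullet> v)"
  have sv: "s \<cdot>\<^sub>v v \<in> carrier_vec n" using v by simp
  have "vnorm (s \<cdot>\<^sub>v v) = sqrt (s\<^sup>2)" using v by (simp add: vnorm_def power2_eq_square)
  hence mem: "W (s \<cdot>\<^sub>v v) \<in> S" unfolding S_def using sv by blast
  have nb: "0 \<le> vnorm b" by (simp add: vnorm_def scalar_prod_self_nonneg)
  have upper: "w \<le> (vnorm b + s)\<^sup>2 / g" if "w \<in> S" for w
  proof -
    from that obtain x where x: "x \<in> carrier_vec n" "vnorm x = s" "w = W x"
      using s unfolding S_def by auto
    have "(b \<bullet> x)\<^sup>2 \<le> (vnorm b * s)\<^sup>2"
      using scalar_prod_Cauchy_Schwarz[OF b x(1)]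
      unfolding power_mult_distrib x(2)[symmetric] vnorm_squared .
    hence "b \<bullet> x \<le> vnorm b * s" using nb s by (elim power2_le_imp_le) simp
    moreover have "(b + x) \<bullet> (b + x) = b \<bullet> b + 2 * (b \<bullet> x) + x \<bullet> x"
      using b x(1) comm_scalar_prod[OF x(1) b]
      by (simp add: add_scalar_prod_distrib[of _ n] scalar_prod_add_distrib[of _ n])
    ultimately have "(b + x) \<bullet> (b + x) \<le> (vnorm b + s)\<^sup>2"
      using x(2) vnorm_squared[of b] vnorm_squared[of x] by (simp add: power2_sum)
    hence "((b + x) \<bullet> (b + x)) / g \<le> (vnorm b + s)\<^sup>2 / g" using g by (intro divide_right_mono) auto
    thus ?thesis using welfare_bounds(1)[OF \<beta> \<mu> b x(1)] unfolding x(3) W_def g_def by linarith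
  qed
  have "col Q 0 \<bullet> (b + s \<cdot>\<^sub>v v) = a"
    using col_top(1) b v by (simp add: a_def scalar_prod_add_distrib[of _ n])
  hence lower: "a\<^sup>2 / g \<le> W (s \<cdot>\<^sub>v v)"
    using welfare_bounds(2)[OF \<beta> \<mu> b sv] by (simp add: W_def g_def)
  have "bdd_above S" using upper by (rule bdd_aboveI)
  hence "W (s \<cdot>\<^sub>v v) \<le> Sup S" using mem by (rule cSup_upper[rotated])
  moreover have "0 < a\<^sup>2 / g" using ne g by (simp add: a_def)
  ultimately have pos: "0 < Sup S" using lower by linarith
  have le: "Sup S \<le> (vnorm b + s)\<^sup>2 / g" using mem upper by (intro cSup_least) auto
  have "(a / (vnorm b + s))\<^sup>2 = (a\<^sup>2 / g) / ((vnorm b + s)\<^sup>2 / g)"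
    using g by (simp add: power_divide)
  also have "\<dots> \<le> (a\<^sup>2 / g) / Sup S" using le pos less_le_trans[OF pos le] g
    by (intro divide_left_mono mult_pos_pos) auto
  also have "\<dots> \<le> W (s \<cdot>\<^sub>v v) / Sup S" using lower pos by (intro divide_right_mono) auto
  finally show ?thesis
    unfolding a_def competitive_ratio_def opt_welfare_def W_def S_def .
qed

text \<open>Dividing numerator and denominator by \<open>s\<close> lets the influence of
  \<open>b\<close> vanish as \<open>s\<close> grows, so the lower bound tends to
  \<open>(col Q 0 \<bullet> v)\<^sup>2\<close>, which strictly exceeds
  \<open>1 - \<epsilon>\<close>.\<close>

lemma competitive_ratio_eventually_ge:
  assumes \<beta>: "0 < \<beta>" and \<mu>: "\<And>i. i < n \<Longrightarrow> \<beta> * \<mu> i < 1"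
    and b: "b \<in> carrier_vec n" and v: "v \<in> carrier_vec n" "v \<bullet> v = 1"
    and \<epsilon>: "\<epsilon> < 1" "1 - \<epsilon> < (col Q 0 \<bullet> v)\<^sup>2"
  shows "\<exists>C0>0. \<forall>C\<ge>C0. competitive_ratio n \<beta> A b C (sqrt C \<cdot>\<^sub>v v) \<ge> 1 - \<epsilon>"
proof -
  define p q where "p = col Q 0 \<bullet> b" and "q = col Q 0 \<bullet> v"
  have "((\<lambda>s. ((p * inverse s + q) / (vnorm b * inverse s + 1))\<^sup>2)
      \<longlongrightarrow> ((p * 0 + q) / (vnorm b * 0 + 1))\<^sup>2) at_top"
    by (intro tendsto_intros tendsto_inverse_0_at_top filterlim_ident) simp
  hence "\<forall>\<^sub>F s in at_top. 1 - \<epsilon> < ((p * inverse s + q) / (vnorm b * inverse s + 1))\<^sup>2"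
    using \<epsilon>(2) by (intro order_tendstoD(1)) (auto simp: q_def)
  then obtain s0 where s0: "\<And>s. s0 \<le> s \<Longrightarrow> 1 - \<epsilon> < ((p * inverse s + q) / (vnorm b * inverse s + 1))\<^sup>2"
    unfolding eventually_at_top_linorder by blast
  \<comment> \<open>The 1 keeps \<open>C0\<close> and \<open>s\<close> positive; the square makes
    \<open>sqrt C\<close> at least \<open>s0\<close>, even for negative \<open>s0\<close>.\<close>
  define C0 where "C0 = max 1 (s0\<^sup>2)"
  have "1 - \<epsilon> \<le> competitive_ratio n \<beta> A b C (sqrt C \<cdot>\<^sub>v v)" if C: "C0 \<le> C" for C
  proof -
    define s where "s = sqrt C"
    have C1: "1 \<le> C" "s0\<^sup>2 \<le> C" using C by (auto simp: C0_def)
    have s: "0 < s" "s\<^sup>2 = C" using C1 by (auto simp: s_def)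
    have "s0 \<le> s" unfolding s_def using C1 by (intro real_le_rsqrt)
    moreover have "(p * inverse s + q) / (vnorm b * inverse s + 1) = (p + s * q) / (vnorm b + s)"
    proof -
      have "(p * inverse s + q) / (vnorm b * inverse s + 1) =
        (s * (p * inverse s + q)) / (s * (vnorm b * inverse s + 1))"
        using s by simp
      also have "s * (p * inverse s + q) = p + s * q" using s by (simp add: algebra_simps)
      also have "s * (vnorm b * inverse s + 1) = vnorm b + s" using s by (simp add: algebra_simps)
      finally show ?thesis .
    qed
    ultimately have *: "1 - \<epsilon> < ((p + s * q) / (vnorm b + s))\<^sup>2" using s0[of s] by simp
    \<comment> \<open>A zero numerator would make the ratio 0, which is below the positive number
      \<open>1 - \<epsilon>\<close>.\<close>
    hence ne: "p + s * q \<noteq> 0" using \<epsilon>(1) by auto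
    have "((p + s * q) / (vnorm b + s))\<^sup>2 \<le> competitive_ratio n \<beta> A b (s\<^sup>2) (s \<cdot>\<^sub>v v)"
      unfolding p_def q_def
      by (rule competitive_ratio_ge[OF \<beta> \<mu> b v s(1) ne[unfolded p_def q_def]])
    thus ?thesis using * unfolding s(2) by (simp add: s_def)
  qed
  thus ?thesis by (intro exI[of _ C0]) (auto simp: C0_def)
qed

end

section \<open>Comparison of the sampled and the expected matrix, and the conclusion\<close>

lemma abs_eigval_le_spectral_radius:
  assumes n: "0 < n" and A: "A \<in> carrier_mat n n" and e: "e \<in># eigvals A"
  shows "\<bar>e\<bar> \<le> spectral_radius (map_mat complex_of_real A)"
proof -
  have cp: "char_poly A \<noteq> 0" using degree_monic_char_poly[OF A] by auto
  hence "eigenvalue A e"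
    using e unfolding eigenvalue_root_char_poly[OF A] by (simp add: eigvals_def)
  then obtain w where "eigenvector A w e" unfolding eigenvalue_def by blast
  hence "complex_of_real e \<in> spectrum (map_mat complex_of_real A)"
    using of_real_hom.eigenvector_hom[OF A] unfolding spectrum_def eigenvalue_def by blast
  hence "cmod (complex_of_real e) \<in> cmod ` spectrum (map_mat complex_of_real A)"
    by (rule imageI)
  hence "cmod (complex_of_real e) \<le> spectral_radius (map_mat complex_of_real A)"
    using A by (intro spectral_radius_mem_max(2)[OF _ n]) auto
  thus ?thesis by simp
qed

text \<open>Passing from \<open>v\<close> to \<open>u\<close> costs \<open>\<Delta>\<close> twice:
  once to move from \<open>Ab\<close> to \<open>A\<close> at \<open>v\<close>, once to move back at
  \<open>u\<close>. In between, \<open>u\<close> maximises the form of \<open>A\<close>. The overlap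
  enters squared, so the sign of \<open>u\<close> is immaterial.\<close>

lemma top_eigenvector_overlap:
  fixes A Ab :: "real mat"
  assumes n: "0 < n" and A: "A \<in> carrier_mat n n"
    and Ab: "Ab \<in> carrier_mat n n" "Ab\<^sup>T = Ab"
    and v: "v \<in> carrier_vec n" "v \<bullet> v = 1" "Ab *\<^sub>v v = lambda1 Ab \<cdot>\<^sub>v v"
    and gap: "inv_gap_le Ab \<kappa>" "\<kappa> * lambda1 Ab < lambda1 Ab"
    and close: "\<And>x. x \<in> carrier_vec n \<Longrightarrow> x \<bullet> x = 1 \<Longrightarrow> \<bar>x \<bullet> ((A - Ab) *\<^sub>v x)\<bar> \<le> \<Delta>"
    and frame: "spectral_frame n A Q \<mu>"
  shows "(1 - (col Q 0 \<bullet> v)\<^sup>2) * ((1 - \<kappa>) * lambda1 Ab) \<le> 2 * \<Delta>"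
proof -
  interpret F: spectral_frame n A Q \<mu> by (rule frame)
  obtain Q' \<mu>' where "spectral_frame n Ab Q' \<mu>'" and \<mu>0: "\<mu>' 0 = lambda1 Ab"
    and \<mu>': "\<And>i. 0 < i \<Longrightarrow> i < n \<Longrightarrow> \<mu>' i \<in># other_eigvals Ab"
    using spectral_frame_exists[OF n Ab] by metis
  then interpret G: spectral_frame n Ab Q' \<mu>' by simp
  define u where "u = col Q 0"
  have u: "u \<in> carrier_vec n" "u \<bullet> u = 1" using F.col_top by (auto simp: u_def)
  have diff: "x \<bullet> ((A - Ab) *\<^sub>v x) = x \<bullet> (A *\<^sub>v x) - x \<bullet> (Ab *\<^sub>v x)" if "x \<in> carrier_vec n" for x
    using that A Ab by (simp add: minus_mult_distrib_mat_vec[of _ n n] scalar_prod_minus_distrib[of _ n])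
  have g: "\<mu>' i \<le> \<kappa> * lambda1 Ab" if "0 < i" "i < n" for i
    using gap(1) \<mu>'[OF that] unfolding inv_gap_le_def by fastforce
  have "lambda1 Ab = v \<bullet> (Ab *\<^sub>v v)" using v by simp
  also have "\<dots> \<le> v \<bullet> (A *\<^sub>v v) + \<Delta>" using close[OF v(1,2)] diff[OF v(1)] by linarith
  also have "v \<bullet> (A *\<^sub>v v) \<le> u \<bullet> (A *\<^sub>v u)"
    using F.rayleigh_le[OF v(1)] v(2) by (simp add: u_def F.quadratic_form_col_top)
  also have "u \<bullet> (A *\<^sub>v u) \<le> u \<bullet> (Ab *\<^sub>v u) + \<Delta>" using close[OF u] diff[OF u(1)] by linarith
  also have "u \<bullet> (Ab *\<^sub>v u) \<le>
      lambda1 Ab * (u \<bullet> v)\<^sup>2 + \<kappa> * lambda1 Ab * (1 - (u \<bullet> v)\<^sup>2)"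
    using G.quadratic_form_le_gap[OF v(1,2) _ g _ u] v(3) gap(2) unfolding \<mu>0 by simp
  finally have le: "lambda1 Ab \<le>
      lambda1 Ab * (u \<bullet> v)\<^sup>2 + \<kappa> * lambda1 Ab * (1 - (u \<bullet> v)\<^sup>2) + \<Delta> + \<Delta>" by simp
  have id: "(1 - t) * ((1 - \<kappa>) * l) = l - (l * t + \<kappa> * l * (1 - t))" for t l :: real
    by (simp add: algebra_simps)
  show ?thesis using le id[of "(u \<bullet> v)\<^sup>2" "lambda1 Ab"] unfolding u_def by linarith
qed

theorem theorem1:
  fixes n :: nat and Ab :: "real mat" and \<epsilon> \<delta> \<beta> :: real and b :: "real Matrix.vec"
  assumes "0 < n"
    and "edge_prob_matrix n Ab"
    and "0 < \<epsilon>" "\<epsilon> < 1" "0 < \<delta>" "\<delta> < 1"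
    and "concentration n Ab \<epsilon> \<delta>"
    and "0 < \<beta>"
    and "b \<in> carrier_vec n" "\<forall>i<n. vec_index b i \<ge> 0"
  shows "measure_pmf.prob (random_graph n Ab)
           {A. spectral_radius (map_mat complex_of_real A) < 1 / \<beta> \<longrightarrow>
               (\<exists>C0>0. \<forall>C\<ge>C0.
                  competitive_ratio n \<beta> A b C (sqrt C \<cdot>\<^sub>v v1 Ab) \<ge> 1 - \<epsilon>)}
         \<ge> 1 - \<delta>"
proof -
  note n = \<open>0 < n\<close> and \<epsilon> = \<open>0 < \<epsilon>\<close> \<open>\<epsilon> < 1\<close> and \<delta> = \<open>0 < \<delta>\<close> \<open>\<delta> < 1\<close>
  define L where "L = ln (2 * real n / \<delta>)"
  define d where "d = d_max n Ab"
  define \<Delta> where "\<Delta> = 16 * sqrt (d * L)"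
  define v where "v = v1 Ab"
  define I where "I = {(i, j). i \<le> j \<and> j < n}"
  define graph :: "(nat \<times> nat \<Rightarrow> bool) \<Rightarrow> real mat" where
    "graph E = Matrix.mat n n (\<lambda>(i, j). if E (min i j, max i j) then 1 else 0)" for E
  define P where "P = Pi_pmf I False (\<lambda>e. bernoulli_pmf (Ab $$ e))"
  have Ab: "Ab \<in> carrier_mat n n"
    and Abs: "\<And>i j. i < n \<Longrightarrow> j < n \<Longrightarrow> Ab $$ (i, j) = Ab $$ (j, i)"
    and Ab0: "\<And>i j. i < n \<Longrightarrow> j < n \<Longrightarrow> 0 \<le> Ab $$ (i, j)"
    and Ab1: "\<And>i j. i < n \<Longrightarrow> j < n \<Longrightarrow> Ab $$ (i, j) \<le> 1"
    using assms(2) unfolding edge_prob_matrix_def by auto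
  have AbT: "Ab\<^sup>T = Ab" using Ab Abs by (intro eq_matI) auto
  have mm: "Ab $$ (min i j, max i j) = Ab $$ (i, j)" if "i < n" "j < n" for i j
    using Abs[OF that] by (auto simp: min_def max_def)
  obtain \<kappa> where dL: "4 / 9 * L \<le> d" and \<kappa>: "\<kappa> < 1" "inv_gap_le Ab \<kappa>"
    "1024 * sqrt (d * L) / \<epsilon>\<^sup>2 \<le> lambda1 Ab * (1 - \<kappa>\<^sup>2)"
    using assms(7) unfolding concentration_def L_def d_def by blast
  have "1 < 2 * real n / \<delta>" using n \<delta> by (simp add: field_simps)
  hence L: "0 < L" by (simp add: L_def)
  have S: "0 < sqrt (d * L)" using L dL by simp
  have "0 < lambda1 Ab * (1 - \<kappa>\<^sup>2)"
    using \<kappa>(3) S \<epsilon> by (intro less_le_trans[OF _ \<kappa>(3)]) simp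
  moreover have "0 \<le> lambda1 Ab" using lambda1_nonneg[OF n Ab AbT Ab0] .
  \<comment> \<open>\<open>1 - \<kappa>\<^sup>2\<close> is negative if
    \<open>\<kappa> < - 1\<close>, so the positive product fixes the sign only together with
    nonnegativity of \<open>lambda1 Ab\<close>.\<close>
  ultimately have l1: "0 < lambda1 Ab" by (cases "lambda1 Ab = 0") auto
  \<comment> \<open>This rearranges that \<open>(1 - \<kappa>)\<^sup>2\<close> is nonnegative; the
    factor 2 turns 1024 into 512 below.\<close>
  have "1 - \<kappa>\<^sup>2 \<le> 2 * (1 - \<kappa>)"
    using zero_le_power2[of "1 - \<kappa>"] by (simp add: power2_diff)
  hence "lambda1 Ab * (1 - \<kappa>\<^sup>2) \<le> lambda1 Ab * (2 * (1 - \<kappa>))"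
    using l1 by (intro mult_left_mono) auto
  also have "\<dots> = 2 * ((1 - \<kappa>) * lambda1 Ab)" by simp
  finally have "2 * (512 * sqrt (d * L) / \<epsilon>\<^sup>2) \<le> 2 * ((1 - \<kappa>) * lambda1 Ab)"
    using \<kappa>(3) by simp
  hence gap: "512 * sqrt (d * L) / \<epsilon>\<^sup>2 \<le> (1 - \<kappa>) * lambda1 Ab" by linarith
  have v: "v \<in> carrier_vec n" "v \<bullet> v = 1" "Ab *\<^sub>v v = lambda1 Ab \<cdot>\<^sub>v v"
    unfolding v_def using v1_eigenvector[OF n Ab AbT Ab0] by auto
  have deg: "(\<Sum>y<n. Ab $$ (min y x, max y x)) \<le> d" if x: "x < n" for x
  proof -
    have "(\<Sum>y<n. Ab $$ (min y x, max y x)) = (\<Sum>y<n. Ab $$ (x, y))"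
      using x by (intro sum.cong refl) (metis mm Abs lessThan_iff)
    also have "\<dots> \<le> d" unfolding d_def d_max_def using x by (intro Max_ge) auto
    finally show ?thesis .
  qed
  have noise: "noise_mat n (\<lambda>e. Ab $$ e) E = graph E - Ab" for E
    using Ab by (intro eq_matI) (auto simp: noise_mat_def graph_def mm)
  let ?good = "{E. \<forall>u\<in>carrier_vec n. u \<bullet> u = 1 \<longrightarrow> \<bar>u \<bullet> ((graph E - Ab) *\<^sub>v u)\<bar> \<le> \<Delta>}"
  let ?goal = "{A. spectral_radius (map_mat complex_of_real A) < 1 / \<beta> \<longrightarrow>
               (\<exists>C0>0. \<forall>C\<ge>C0. competitive_ratio n \<beta> A b C (sqrt C \<cdot>\<^sub>v v) \<ge> 1 - \<epsilon>)}"
  have "1 - \<delta> \<le> measure_pmf.prob P ?good"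
    unfolding P_def I_def \<Delta>_def L_def noise[symmetric]
  proof (rule noise_mat_concentration[OF n \<delta>])
    fix e assume "e \<in> {(i, j). i \<le> j \<and> j < n}"
    thus "0 \<le> Ab $$ e \<and> Ab $$ e \<le> 1" by (auto intro: Ab0 Ab1)
  qed (use deg dL in \<open>auto simp: L_def\<close>)
  \<comment> \<open>From here on the argument is deterministic, for one fixed outcome
    \<open>E\<close> of the coins.\<close>
  also have "\<dots> \<le> measure_pmf.prob P (graph -` ?goal)"
  proof (intro measure_pmf.finite_measure_mono subsetI vimageI2 CollectI impI)
    fix E assume E: "E \<in> ?good"
      and rad: "spectral_radius (map_mat complex_of_real (graph E)) < 1 / \<beta>"
    have A: "graph E \<in> carrier_mat n n" by (simp add: graph_def)
    have AT: "(graph E)\<^sup>T = graph E"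
      by (rule eq_matI) (auto simp: graph_def min.commute max.commute)
    obtain Q \<mu> where frame: "spectral_frame n (graph E) Q \<mu>"
      and \<mu>: "\<And>i. i < n \<Longrightarrow> \<mu> i \<in># eigvals (graph E)"
      using spectral_frame_exists[OF n A AT] by metis
    define q where "q = 1 - (col Q 0 \<bullet> v)\<^sup>2"
    have "q * ((1 - \<kappa>) * lambda1 Ab) \<le> 2 * \<Delta>" unfolding q_def
      using E l1 \<kappa> by (intro top_eigenvector_overlap[OF n A Ab AbT v \<kappa>(2) _ _ frame]) auto
    have "q < \<epsilon>"
    \<comment> \<open>If \<open>q\<close> is negative, the claim is immediate; only the other case
      uses the gap.\<close>
    proof (cases "0 \<le> q")
      case True
      have "q * (512 * sqrt (d * L) / \<epsilon>\<^sup>2) \<le> q * ((1 - \<kappa>) * lambda1 Ab)"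
        using gap True by (rule mult_left_mono)
      \<comment> \<open>The constants 512 and 32 leave
        \<open>16 * q \<le> \<epsilon>\<^sup>2\<close>, well inside
        \<open>q < \<epsilon>\<close>.\<close>
      also have "\<dots> \<le> 32 * sqrt (d * L)" using \<open>q * _ \<le> 2 * \<Delta>\<close> by (simp add: \<Delta>_def)
      finally have "16 * q * sqrt (d * L) \<le> \<epsilon>\<^sup>2 * sqrt (d * L)" using \<epsilon> by (simp add: field_simps)
      hence "16 * q \<le> \<epsilon>\<^sup>2" using S by (rule mult_right_le_imp_le)
      also have "\<dots> \<le> \<epsilon>" using \<epsilon> by (simp add: power2_eq_square mult_left_le)
      finally show ?thesis using \<epsilon> True by linarith
    qed (use \<epsilon> in linarith)
    hence q: "1 - \<epsilon> < (col Q 0 \<bullet> v)\<^sup>2" by (simp add: q_def)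
    have \<beta>\<mu>: "\<beta> * \<mu> i < 1" if "i < n" for i
    proof -
      \<comment> \<open>This is where the hypothesis on the spectral radius enters; it makes the
        resolvent positive in the eigenbasis.\<close>
      have "\<mu> i < 1 / \<beta>"
        using abs_eigval_le_spectral_radius[OF n A \<mu>[OF that]] rad by linarith
      thus ?thesis using \<open>0 < \<beta>\<close> by (simp add: field_simps)
    qed
    show "\<exists>C0>0. \<forall>C\<ge>C0. competitive_ratio n \<beta> (graph E) b C (sqrt C \<cdot>\<^sub>v v) \<ge> 1 - \<epsilon>"
      by (rule spectral_frame.competitive_ratio_eventually_ge
          [OF frame \<open>0 < \<beta>\<close> \<beta>\<mu> assms(9) v(1,2) \<epsilon>(2) q])
  qed auto
  also have "measure_pmf.prob P (graph -` ?goal) = measure_pmf.prob (random_graph n Ab) ?goal"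
  proof -
    have "random_graph n Ab = map_pmf graph P"
      unfolding random_graph_def P_def I_def graph_def
      by (simp add: case_prod_unfold)
    thus ?thesis by simp
  qed
  finally show ?thesis unfolding v_def .
qed

end
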